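(* Let $\alpha<\beta$ be coprime positive integers, let $n$ be a positive integer and let $\ell$ be a positive divisor of $n$. Then there are \[ \frac{1}{n}\binom{\frac{\alpha}{\gcd(\frac{n}{\ell},\alpha)}-1}{\ell\cdot\gcd(\frac{n}{\ell},\beta)-1}\binom{\frac{\beta}{\gcd(\frac{n}{\ell},\beta)}-1}{\ell\cdot\gcd(\frac{n}{\ell},\alpha)-1} \] $\langle\alpha,\beta\rangle$-semimodules $\Delta$ (counted up to isomorphism) with $\mathrm{Syz}^{(\ell)}(\Delta)\cong\Delta$ generated by $n$ elements (i.e. whose minimal system of generators has $n$ elements).
   Context: $\mathbb N$ contains $0$. $\Gamma=\langle\alpha,\beta\rangle=\{a\alpha+b\beta \mid a,b\in\mathbb N\}$. A $\Gamma$-semimodule is a non-empty subset $\Delta\subseteq\mathbb N$ with $\Delta+\Gamma\subseteq\Delta$. A system of generators of $\Delta$ is a subset $E\subseteq\Delta$ with $\bigcup_{x\in E}(x+\Gamma)=\Delta$; every semimodule has a unique minimal system of generators, which is finite. Two semimodules $\Delta,\Delta'$ are isomorphic, $\Delta\cong\Delta'$, if there is an integer $c$ such that $x\mapsto x+c$ is a bijection $\Delta\to\Delta'$. For a $\Gamma$-semimodule $\Delta$ with minimal system of generators $E$, its syzygy is \[\mathrm{Syz}(\Delta)=\bigcup_{i,i'\in E,\ i\ne i'}\big((i+\Gamma)\cap(i'+\Gamma)\big).\] Iterating, $\mathrm{Syz}^{(1)}(\Delta)=\mathrm{Syz}(\Delta)$ and $\mathrm{Syz}^{(k)}(\Delta)=\mathrm{Syz}(\mathrm{Syz}^{(k-1)}(\Delta))$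 for $k\ge2$.
   Formalization: The formula is asserted only when n ≥ 2 and n/ℓ divides αβ; in all other cases it is proved that there are no such semimodules. As stated the claim fails: for α=3, β=5, n=2, ℓ=1 the formula gives 1/2, and for n=1 the syzygy is empty while the formula gives 1. *)

theory Defs
  imports Complex_Main
begin

definition num_semigroup :: "nat \<Rightarrow> nat \<Rightarrow> nat set" where
  "num_semigroup \<alpha> \<beta> = {a * \<alpha> + b * \<beta> | a b. True}"

definition translate :: "nat set \<Rightarrow> nat \<Rightarrow> nat set" where
  "translate \<Gamma> x = {x + g | g. g \<in> \<Gamma>}"

definition semimodule :: "nat set \<Rightarrow> nat set \<Rightarrow> bool" where
  "semimodule \<Gamma> \<Delta> \<longleftrightarrow> \<Delta> \<noteq> {} \<and> (\<forall>x\<in>\<Delta>. \<forall>g\<in>\<Gamma>. x + g \<in> \<Delta>)"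

definition generating_system :: "nat set \<Rightarrow> nat set \<Rightarrow> nat set \<Rightarrow> bool" where
  "generating_system \<Gamma> \<Delta> E \<longleftrightarrow> E \<subseteq> \<Delta> \<and> (\<Union>x\<in>E. translate \<Gamma> x) = \<Delta>"

definition minimal_generating_system :: "nat set \<Rightarrow> nat set \<Rightarrow> nat set \<Rightarrow> bool" where
  "minimal_generating_system \<Gamma> \<Delta> E \<longleftrightarrow>
     generating_system \<Gamma> \<Delta> E \<and> (\<forall>E'. E' \<subset> E \<longrightarrow> \<not> generating_system \<Gamma> \<Delta> E')"

definition min_gens :: "nat set \<Rightarrow> nat set \<Rightarrow> nat set" where
  "min_gens \<Gamma> \<Delta> = (THE E. minimal_generating_system \<Gamma> \<Delta> E)"

text \<open>The description \<open>THE\<close> is justified: the minimal generating system exists and is unique.\<close>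

lemma minimal_generating_system_unique:
  assumes zero: "0 \<in> \<Gamma>" and sm: "\<And>x g. x \<in> \<Delta> \<Longrightarrow> g \<in> \<Gamma> \<Longrightarrow> x + g \<in> \<Delta>"
    and add: "\<And>g h. g \<in> \<Gamma> \<Longrightarrow> h \<in> \<Gamma> \<Longrightarrow> g + h \<in> \<Gamma>"
  shows "\<exists>!E. minimal_generating_system \<Gamma> \<Delta> E"
proof -
  define M where "M = {x \<in> \<Delta>. \<forall>y\<in>\<Delta>. \<forall>g\<in>\<Gamma>. x = y + g \<longrightarrow> g = 0}"
  have sub: "M \<subseteq> E" if "generating_system \<Gamma> \<Delta> E" for E
  proof
    fix x assume x: "x \<in> M"
    then have "x \<in> (\<Union>y\<in>E. translate \<Gamma> y)"
      using that by (simp add: M_def generating_system_def)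
    then obtain y g where yg: "y \<in> E" "g \<in> \<Gamma>" "x = y + g"
      by (auto simp: translate_def)
    moreover have "y \<in> \<Delta>" using that yg(1) by (auto simp: generating_system_def)
    ultimately show "x \<in> E" using x by (auto simp: M_def)
  qed
  have ex: "\<exists>m\<in>M. \<exists>g\<in>\<Gamma>. x = m + g" if "x \<in> \<Delta>" for x
    using that
  proof (induction x rule: less_induct)
    case (less x)
    show ?case
    proof (cases "x \<in> M")
      case True
      then show ?thesis using zero by (intro bexI[of _ x] bexI[of _ 0]) auto
    next
      case False
      then obtain y g where yg: "y \<in> \<Delta>" "g \<in> \<Gamma>" "x = y + g" "g \<noteq> 0"
        using less.prems by (auto simp: M_def)
      then obtain m h where "m \<in> M" "h \<in> \<Gamma>" "y = m + h"
        using less.IH[of y] by auto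
      then show ?thesis using yg add[of h g] by (metis add.assoc)
    qed
  qed
  have gen: "generating_system \<Gamma> \<Delta> M"
  proof -
    have "M \<subseteq> \<Delta>" by (auto simp: M_def)
    then show ?thesis
      using ex sm by (fastforce simp: generating_system_def translate_def)
  qed
  show ?thesis
  proof (rule ex1I[of _ M])
    show "minimal_generating_system \<Gamma> \<Delta> M"
      using gen sub unfolding minimal_generating_system_def by blast
  next
    fix E assume "minimal_generating_system \<Gamma> \<Delta> E"
    then show "E = M"
      using gen sub unfolding minimal_generating_system_def by blast
  qed
qed

definition syz :: "nat set \<Rightarrow> nat set \<Rightarrow> nat set" where
  "syz \<Gamma> \<Delta> = (\<Union>i\<in>min_gens \<Gamma> \<Delta>. \<Union>i'\<in>min_gens \<Gamma> \<Delta> - {i}. translate \<Gamma> i \<inter> translate \<Gamma> i')"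

text \<open>The shift \<open>c\<close> may be negative, hence the passage to \<^typ>\<open>int\<close>.\<close>

definition semimodule_iso :: "nat set \<Rightarrow> nat set \<Rightarrow> bool" where
  "semimodule_iso \<Delta> \<Delta>' \<longleftrightarrow> (\<exists>c::int. bij_betw (\<lambda>x. int x + c) \<Delta> (int ` \<Delta>'))"

definition iso_rel :: "nat set \<Rightarrow> (nat set \<times> nat set) set" where
  "iso_rel \<Gamma> = {(\<Delta>, \<Delta>'). semimodule \<Gamma> \<Delta> \<and> semimodule \<Gamma> \<Delta>' \<and> semimodule_iso \<Delta> \<Delta>'}"

text \<open>Isomorphism classes of the semimodules with \<open>n\<close> minimal generators that are isomorphic to
  their \<open>l\<close>-th syzygy. Note that \<^const>\<open>syz\<close> of a semimodule with a single generator is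
  empty, hence not a semimodule, and never isomorphic to it.\<close>

definition syz_periodic_classes :: "nat set \<Rightarrow> nat \<Rightarrow> nat \<Rightarrow> nat set set set" where
  "syz_periodic_classes \<Gamma> n l =
     {\<Delta>. semimodule \<Gamma> \<Delta> \<and> card (min_gens \<Gamma> \<Delta>) = n \<and> semimodule_iso ((syz \<Gamma> ^^ l) \<Delta>) \<Delta>}
       // iso_rel \<Gamma>"

end

theory Submission
  imports Defs
begin

text \<open>
  Pulling a semimodule back along the map sending \<open>(p, q)\<close> to \<open>p\<alpha> - q\<beta>\<close> from
  pairs of integers to integers gives a region bounded by a staircase that is invariant under
  translation by \<open>(\<beta>, \<alpha>)\<close>. If its corners are \<open>(H i, V i)\<close>, indexed by all integers, then
  \<open>H\<close> and \<open>V\<close> are strictly increasing with \<open>H (i + n) = H i + \<beta>\<close> and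
  \<open>V (i + n) = V i + \<alpha>\<close>, where \<open>n\<close> is the number of minimal generators. Minimal generators are
  the corners, an isomorphism is a common index shift together with additive constants, and the
  syzygy replaces \<open>H i\<close> by \<open>H (i + 1)\<close> while leaving \<open>V\<close> alone. Hence the \<open>l\<close>-th syzygy is
  isomorphic to the semimodule iff for some \<open>k\<close> the increments of \<open>V\<close> have period \<open>k\<close> and those of
  \<open>H\<close> have period \<open>k + l\<close>. By coprimality this means, for \<open>m = n / l\<close>, that \<open>m\<close> divides
  \<open>\<alpha>\<beta>\<close> and the increments of \<open>H\<close> and \<open>V\<close> have periods \<open>n / gcd m \<beta>\<close> and \<open>n / gcd m \<alpha>\<close>.
  Such pairs are pairs of compositions, counted by binomial coefficients, and again by coprimality
  the cyclic group of order \<open>n\<close> acts on them freely by rotation, which accounts for the factor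
  \<open>1 / n\<close>.
\<close>

subsection \<open>Periodic staircases\<close>

text \<open>Indexing the corners by all integers turns a rotation into a shift of the argument,
  without bookkeeping at the end of a period.\<close>

definition stairs :: "nat \<Rightarrow> nat \<Rightarrow> (int \<Rightarrow> int) set" where
  "stairs n s = {H. strict_mono H \<and> (\<forall>i. H (i + int n) = H i + int s)}"

lemma stairs_strict_mono: "H \<in> stairs n s \<Longrightarrow> strict_mono H"
  by (simp add: stairs_def)

lemma stairs_less_iff: "H \<in> stairs n s \<Longrightarrow> H i < H j \<longleftrightarrow> i < j"
  by (simp add: stairs_def strict_mono_less)

lemma stairs_le_iff: "H \<in> stairs n s \<Longrightarrow> H i \<le> H j \<longleftrightarrow> i \<le> j"
  by (simp add: stairs_def strict_mono_less_eq)

lemma stairs_eq_iff: "H \<in> stairs n s \<Longrightarrow> H i = H j \<longleftrightarrow> i = j"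
  by (simp add: stairs_def strict_mono_eq)

lemma stairs_add_mult:
  assumes "H \<in> stairs n s"
  shows "H (i + k * int n) = H i + k * int s"
proof (induction k rule: int_induct[of _ 0])
  case base
  show ?case by simp
next
  case (step1 k)
  have "H (i + (k + 1) * int n) = H ((i + k * int n) + int n)"
    by (simp add: algebra_simps)
  also have "\<dots> = H (i + k * int n) + int s"
    using assms unfolding stairs_def by blast
  finally show ?case using step1 by (simp add: algebra_simps)
next
  case (step2 k)
  have "H (i + k * int n) = H ((i + (k - 1) * int n) + int n)"
    by (simp add: algebra_simps)
  also have "\<dots> = H (i + (k - 1) * int n) + int s"
    using assms unfolding stairs_def by blast
  finally show ?case using step2 by (simp add: algebra_simps)
qed

lemma stairs_shift:
  assumes "H \<in> stairs n s"
  shows "(\<lambda>i. H (i + k) + a) \<in> stairs n s"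
proof -
  have "H (i + int n + k) = H (i + k) + int s" for i
    using stairs_add_mult[OF assms, of "i + k" 1] by (simp add: algebra_simps)
  then show ?thesis
    using stairs_less_iff[OF assms] by (simp add: stairs_def strict_mono_def)
qed

section \<open>Increasing integer sequences and enumeration of periodic sets\<close>

lemma strict_mono_intI:
  fixes f :: "int \<Rightarrow> int"
  assumes "\<And>i. f i < f (i + 1)"
  shows "strict_mono f"
proof (rule strict_monoI)
  fix i j :: int
  assume "i < j"
  then show "f i < f j"
  proof (induction j rule: int_gr_induct)
    case base
    show ?case by (rule assms)
  next
    case (step j)
    then show ?case using assms[of j] by simp
  qed
qed

text \<open>The integer \<open>f i + 1\<close> is a value of \<open>f\<close>, attained to the right
  of \<open>i\<close>, so \<open>f (i + 1)\<close> cannot exceed it: every step is exactly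
  1.\<close>

lemma strict_mono_surj_int_shift:
  fixes f :: "int \<Rightarrow> int"
  assumes f: "strict_mono f" and surj: "surj f"
  shows "f i = i + f 0"
proof -
  have step: "f (i + 1) = f i + 1" for i
  proof -
    obtain j where j: "f i + 1 = f j" using surj by (meson surjE)
    then have "i < j" using strict_mono_less[OF f, of i j] by simp
    then have "f (i + 1) \<le> f j" using strict_mono_less_eq[OF f] by simp
    moreover have "f i < f (i + 1)" using strict_mono_less[OF f] by simp
    ultimately show ?thesis using j by simp
  qed
  show ?thesis
  proof (induction i rule: int_induct[of _ 0])
    case (step2 i)
    then show ?case using step[of "i - 1"] by simp
  qed (use step in simp_all)
qed

text \<open>Sending \<open>i\<close> to the position of \<open>H' i\<close> in the enumeration
  \<open>H\<close> is an order automorphism of the integers, hence a translation.\<close>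

lemma strict_mono_range_eq_shift:
  fixes H H' :: "int \<Rightarrow> int"
  assumes H: "strict_mono H" and H': "strict_mono H'" and range: "range H = range H'"
  obtains k where "\<And>i. H' i = H (i + k)"
proof -
  define \<pi> where "\<pi> i = inv H (H' i)" for i
  have \<pi>: "H' i = H (\<pi> i)" for i
    using range by (simp add: \<pi>_def f_inv_into_f)
  have "strict_mono \<pi>"
  proof (rule strict_monoI)
    fix i j :: int assume "i < j"
    then have "H (\<pi> i) < H (\<pi> j)" using strict_mono_less[OF H'] by (simp flip: \<pi>)
    then show "\<pi> i < \<pi> j" using strict_mono_less[OF H] by simp
  qed
  moreover have "surj \<pi>"
  proof (rule surjI)
    fix j
    have "H j \<in> range H'" using range by blast
    then have "H j = H (\<pi> (inv H' (H j)))" using \<pi> by (metis f_inv_into_f)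
    then show "\<pi> (inv H' (H j)) = j" using strict_mono_eq[OF H] by simp
  qed
  ultimately have "\<pi> i = i + \<pi> 0" for i by (rule strict_mono_surj_int_shift)
  then show ?thesis using that \<pi> by metis
qed

text \<open>The residues occurring in the window \<open>[0, s)\<close> are listed in increasing
  order and continued periodically; \<open>n\<close> is their number.\<close>

lemma periodic_set_enumeration:
  fixes P :: "int set" and s :: nat
  assumes s: "0 < s" and ne: "P \<noteq> {}" and per: "\<And>p k. p \<in> P \<Longrightarrow> p + k * int s \<in> P"
  obtains n H where "0 < n" "H \<in> stairs n s" "range H = P"
proof -
  define xs where "xs = sorted_list_of_set (P \<inter> {0..<int s})"
  define n where "n = length xs"
  have set_xs: "set xs = P \<inter> {0..<int s}" by (simp add: xs_def)
  have red: "p mod int s \<in> set xs" if "p \<in> P" for p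
  proof -
    have "p mod int s = p + (- (p div int s)) * int s"
      using minus_mult_div_eq_mod [of p "int s"] by (simp add: algebra_simps)
    then have "p mod int s \<in> P" using per[OF that, of "- (p div int s)"] by simp
    then show ?thesis using s set_xs by simp
  qed
  have n: "0 < n" using ne red by (auto simp: n_def)
  have sorted: "sorted_wrt (<) xs" by (simp add: xs_def)
  define H where "H i = xs ! nat (i mod int n) + int s * (i div int n)" for i
  have idx: "nat (i mod int n) < length xs" for i
    using n by (simp add: n_def nat_less_iff)
  have "strict_mono H"
  proof (rule strict_mono_intI)
    fix i
    define q r where "q = i div int n" and "r = i mod int n"
    have i: "i = r + q * int n" and r: "0 \<le> r" "r < int n"
      using n by (simp_all add: q_def r_def)
    \<comment> \<open>Inside a window the list increases. At the wrap-around the offset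
      \<open>s\<close> outweighs the drop back to \<open>xs ! 0\<close>, because all entries lie in
      \<open>[0, s)\<close>.\<close>
    show "H i < H (i + 1)"
    proof (cases "r + 1 < int n")
      case True
      have "(i + 1) mod int n = r + 1"
        using True r i mod_mult_self1[of "r + 1" q "int n"] by (simp add: algebra_simps)
      moreover have "(i + 1) div int n = q"
        using True r n i div_mult_self1[of "int n" "r + 1" q] by (simp add: algebra_simps)
      moreover have "xs ! nat r < xs ! nat (r + 1)"
        using sorted_wrt_nth_less[OF sorted, of "nat r" "nat (r + 1)"] True r n_def by linarith
      ultimately show ?thesis by (simp add: H_def flip: q_def r_def)
    next
      case False
      then have eq: "i + 1 = (q + 1) * int n" using r i by (simp add: algebra_simps)
      have "H (i + 1) = xs ! 0 + int s * (q + 1)"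
        using n unfolding H_def eq by simp
      moreover have "0 \<le> xs ! 0" "xs ! nat r < int s"
        using n set_xs idx[of i] nth_mem[of 0 xs] nth_mem[of "nat r" xs]
        by (auto simp: n_def r_def)
      ultimately show ?thesis by (simp add: H_def algebra_simps flip: q_def r_def)
    qed
  qed
  moreover have "H (i + int n) = H i + int s" for i
    using n by (simp add: H_def algebra_simps)
  ultimately have "H \<in> stairs n s" by (simp add: stairs_def)
  moreover have "range H = P"
  proof
    show "range H \<subseteq> P"
    proof
      fix p assume "p \<in> range H"
      then obtain i where "p = H i" by blast
      moreover have "xs ! nat (i mod int n) \<in> P" using idx[of i] set_xs nth_mem by blast
      ultimately show "p \<in> P"
        using per[of _ "i div int n"] by (simp add: H_def mult.commute)
    qed
    show "P \<subseteq> range H"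
    proof
      fix p assume "p \<in> P"
      then obtain j where j: "j < n" "xs ! j = p mod int s"
        using red by (metis in_set_conv_nth n_def)
      have "H (int j + (p div int s) * int n) = p"
        using j n by (simp add: H_def)
      then show "p \<in> range H" by (metis rangeI)
    qed
  qed
  ultimately show ?thesis using that n by blast
qed

section \<open>Staircases normalised at index 0 and their number\<close>

definition stairs0 :: "nat \<Rightarrow> nat \<Rightarrow> (int \<Rightarrow> int) set" where
  "stairs0 n s = {H \<in> stairs n s. H 0 = 0}"

lemma stairs0_period: "H \<in> stairs0 n s \<Longrightarrow> H (int n) = int s"
  using stairs_add_mult[of H n s 0 1] by (simp add: stairs0_def)

lemma stairs0_range_Int:
  assumes "H \<in> stairs0 n s"
  shows "range H \<inter> {0..<int s} = H ` {0..<int n}"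
proof -
  have H: "H \<in> stairs n s" and "H 0 = 0" using assms by (auto simp: stairs0_def)
  then have "H i \<in> {0..<int s} \<longleftrightarrow> i \<in> {0..<int n}" for i
    using stairs_le_iff[OF H, of 0 i] stairs_less_iff[OF H, of i "int n"] stairs0_period[OF assms]
    by simp
  then show ?thesis by blast
qed

lemma stairs0_image_ge1:
  assumes "H \<in> stairs0 n s" and "0 < n"
  shows "H ` {1..<int n} = range H \<inter> {1..<int s}"
proof -
  have H: "H \<in> stairs n s" and H0: "H 0 = 0" using assms by (auto simp: stairs0_def)
  have "H i \<in> {1..<int s} \<longleftrightarrow> i \<in> {1..<int n}" for i
    using stairs_less_iff[OF H, of 0 i] stairs_less_iff[OF H, of i "int n"]
      stairs0_period[OF assms(1)] H0
    by auto
  then show ?thesis by blast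
qed

lemma stairs_range_mod:
  assumes "H \<in> stairs n s"
  shows "p \<in> range H \<longleftrightarrow> p mod int s \<in> range H"
proof -
  have *: "p + k * int s \<in> range H" if "p \<in> range H" for p k
    using that stairs_add_mult[OF assms] by (metis rangeE rangeI)
  have "p mod int s + (p div int s) * int s = p" "p + (- (p div int s)) * int s = p mod int s"
    using minus_mult_div_eq_mod [of p "int s"] by (simp_all add: algebra_simps)
  then show ?thesis using *[of p "- (p div int s)"] *[of "p mod int s" "p div int s"] by metis
qed

text \<open>Normalised staircases are compositions of \<open>s\<close> into \<open>n\<close>
  positive parts, recorded by their interior partial sums. The interior values determine the whole
  range by periodicity, the range determines the staircase up to an index shift, and the value 0 at
  index 0 excludes a nonzero shift.\<close>

lemma bij_betw_stairs0:
  assumes "0 < n" and s: "0 < s"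
  shows "bij_betw (\<lambda>H. H ` {1..<int n}) (stairs0 n s) {B. B \<subseteq> {1..<int s} \<and> card B = n - 1}"
proof (rule bij_betw_imageI)
  show "inj_on (\<lambda>H. H ` {1..<int n}) (stairs0 n s)"
  proof (rule inj_onI)
    fix H H' assume *: "H \<in> stairs0 n s" "H' \<in> stairs0 n s" "H ` {1..<int n} = H' ` {1..<int n}"
    have H: "H \<in> stairs n s" "H 0 = 0" "H' \<in> stairs n s" "H' 0 = 0"
      using * by (auto simp: stairs0_def)
    have "p \<in> range H \<longleftrightarrow> p \<in> range H'" for p
    proof -
      have "p mod int s = 0 \<or> p mod int s \<in> {1..<int s}"
        using s pos_mod_bound[of "int s" p] pos_mod_sign[of "int s" p]
        unfolding atLeastLessThan_iff by linarith
      moreover have "0 \<in> range H" "0 \<in> range H'" using H by (metis rangeI)+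
      moreover have "range H \<inter> {1..<int s} = range H' \<inter> {1..<int s}"
        using * assms stairs0_image_ge1 by metis
      ultimately show ?thesis
        using stairs_range_mod[OF H(1), of p] stairs_range_mod[OF H(3), of p] by auto
    qed
    then have "range H = range H'" by blast
    then obtain k where k: "\<And>i. H' i = H (i + k)"
      using strict_mono_range_eq_shift H stairs_strict_mono by metis
    then have "H k = H 0" using H by (metis add_0)
    then have "k = 0" using stairs_eq_iff[OF H(1)] by simp
    then show "H = H'" using k by auto
  qed
  show "(\<lambda>H. H ` {1..<int n}) ` stairs0 n s = {B. B \<subseteq> {1..<int s} \<and> card B = n - 1}"
  proof (intro equalityI subsetI)
    fix B assume "B \<in> (\<lambda>H. H ` {1..<int n}) ` stairs0 n s"
    then obtain H where H: "H \<in> stairs0 n s" "B = H ` {1..<int n}" by blast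
    then have "inj H" using stairs_strict_mono strict_mono_imp_inj_on stairs0_def by blast
    then have "card B = n - 1"
      using H(2) by (simp add: card_image inj_on_subset nat_diff_distrib)
    moreover have "B \<subseteq> {1..<int s}" using stairs0_image_ge1 H assms by blast
    ultimately show "B \<in> {B. B \<subseteq> {1..<int s} \<and> card B = n - 1}" by simp
  next
    fix B assume "B \<in> {B. B \<subseteq> {1..<int s} \<and> card B = n - 1}"
    then have B: "B \<subseteq> {1..<int s}" "card B = n - 1" by auto
    \<comment> \<open>For surjectivity, 0 is adjoined to \<open>B\<close>, the result is extended
      \<open>s\<close>-periodically and then enumerated.\<close>
    define P where "P = {p. p mod int s \<in> insert 0 B}"
    have P0: "0 \<in> P" by (simp add: P_def)
    have "p + k * int s \<in> P" if "p \<in> P" for p k using that by (simp add: P_def)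
    then obtain n' H where H: "0 < n'" "H \<in> stairs n' s" "range H = P"
      using periodic_set_enumeration[OF s, of P] P0 by (metis empty_iff)
    obtain j where j: "0 = H j" using P0 H by blast
    \<comment> \<open>The enumeration need not place 0 at index 0, so it is re-indexed; the summand
      0 matches the form of \<open>stairs_shift\<close>.\<close>
    define K where "K = (\<lambda>i. H (i + j) + 0)"
    have K: "K \<in> stairs0 n' s"
      using stairs_shift[OF H(2), of j 0] j by (simp add: K_def stairs0_def)
    have "range K = P"
      unfolding K_def using H(3) by (auto simp: image_iff) (metis diff_add_cancel)
    have PB: "P \<inter> {0..<int s} = insert 0 B"
    proof -
      have "p \<in> P \<longleftrightarrow> p \<in> insert 0 B" if "p \<in> {0..<int s}" for p
      proof -
        have "p mod int s = p" using that by simp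
        then show ?thesis by (simp only: P_def mem_Collect_eq)
      qed
      moreover have "insert 0 B \<subseteq> {0..<int s}" using B s by auto
      ultimately show ?thesis by blast
    qed
    have "K ` {0..<int n'} = insert 0 B"
      using stairs0_range_Int[OF K] \<open>range K = P\<close> PB by simp
    moreover have "inj K" using K stairs_strict_mono strict_mono_imp_inj_on stairs0_def by blast
    ultimately have "n' = card (insert 0 B)"
      using card_image[of K "{0..<int n'}"] by (simp add: inj_on_subset)
    also have "\<dots> = n"
      using B assms finite_subset[OF B(1)] by (subst card_insert_disjoint) auto
    finally have "n' = n" .
    have "P \<inter> {1..<int s} = (P \<inter> {0..<int s}) \<inter> {1..<int s}" by auto
    also have "\<dots> = B" unfolding PB using B by auto
    finally have "K ` {1..<int n} = B"
      using stairs0_image_ge1[OF K H(1)] \<open>n' = n\<close> \<open>range K = P\<close> by simp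
    then show "B \<in> (\<lambda>H. H ` {1..<int n}) ` stairs0 n s"
      using K \<open>n' = n\<close> by blast
  qed
qed

lemma card_stairs0:
  assumes "0 < n" and "0 < s"
  shows "card (stairs0 n s) = (s - 1) choose (n - 1)"
  using bij_betw_same_card[OF bij_betw_stairs0[OF assms]] assms
  by (simp add: n_subsets nat_diff_distrib)

lemma finite_stairs0:
  assumes "0 < n" and "0 < s"
  shows "finite (stairs0 n s)"
  using bij_betw_finite[OF bij_betw_stairs0[OF assms]]
  by (simp add: finite_subset[OF _ finite_Pow_iff[THEN iffD2, of "{1..<int s}"]])

subsection \<open>Semimodules as staircase regions\<close>

lemma zero_in_num_semigroup: "0 \<in> num_semigroup \<alpha> \<beta>"
  by (auto simp: num_semigroup_def)

lemma add_in_num_semigroup: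
  assumes "g \<in> num_semigroup \<alpha> \<beta>" and "h \<in> num_semigroup \<alpha> \<beta>"
  shows "g + h \<in> num_semigroup \<alpha> \<beta>"
proof -
  obtain a b c d where "g = a * \<alpha> + b * \<beta>" "h = c * \<alpha> + d * \<beta>"
    using assms by (auto simp: num_semigroup_def)
  then have "g + h = (a + c) * \<alpha> + (b + d) * \<beta>" by (simp add: algebra_simps)
  then show ?thesis unfolding num_semigroup_def by blast
qed

lemma minimal_generating_system_min_gens:
  assumes "semimodule (num_semigroup \<alpha> \<beta>) \<Delta>"
  shows "minimal_generating_system (num_semigroup \<alpha> \<beta>) \<Delta> (min_gens (num_semigroup \<alpha> \<beta>) \<Delta>)"
  unfolding min_gens_def
  by (rule theI', rule minimal_generating_system_unique)
     (use assms zero_in_num_semigroup add_in_num_semigroup in \<open>auto simp: semimodule_def\<close>)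

text \<open>An element of \<open>E\<close> dropped from a smaller generating system would be
  generated by another element of \<open>E\<close>, which the antichain property forbids.\<close>

lemma generating_antichain_eq_min_gens:
  assumes sm: "semimodule (num_semigroup \<alpha> \<beta>) \<Delta>"
    and gen: "generating_system (num_semigroup \<alpha> \<beta>) \<Delta> E"
    and anti: "\<And>x y g. x \<in> E \<Longrightarrow> y \<in> E \<Longrightarrow> g \<in> num_semigroup \<alpha> \<beta> \<Longrightarrow> y = x + g \<Longrightarrow> y = x"
  shows "min_gens (num_semigroup \<alpha> \<beta>) \<Delta> = E"
proof -
  have "\<not> generating_system (num_semigroup \<alpha> \<beta>) \<Delta> E'" if "E' \<subset> E" for E'
  proof
    assume E': "generating_system (num_semigroup \<alpha> \<beta>) \<Delta> E'"
    obtain y where y: "y \<in> E" "y \<notin> E'" using \<open>E' \<subset> E\<close> by blast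
    then have "y \<in> (\<Union>x\<in>E'. translate (num_semigroup \<alpha> \<beta>) x)"
      using gen E' by (auto simp: generating_system_def)
    then obtain x g where x: "x \<in> E'" "g \<in> num_semigroup \<alpha> \<beta>" "y = x + g"
      by (auto simp: translate_def)
    then have "y = x" using that y by (intro anti[of x y g]) auto
    then show False using x y by simp
  qed
  then have "minimal_generating_system (num_semigroup \<alpha> \<beta>) \<Delta> E"
    using gen by (simp add: minimal_generating_system_def)
  moreover have "\<exists>!E. minimal_generating_system (num_semigroup \<alpha> \<beta>) \<Delta> E"
    by (rule minimal_generating_system_unique)
       (use sm zero_in_num_semigroup add_in_num_semigroup in \<open>auto simp: semimodule_def\<close>)
  ultimately show ?thesis unfolding min_gens_def by (rule the1_equality[rotated])
qed

text \<open>If \<open>y = x + g\<close> with \<open>y\<close> different from \<open>x\<close>, then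
  everything generated by \<open>y\<close> is already generated by \<open>x\<close>, so removing
  \<open>y\<close> contradicts minimality.\<close>

lemma min_gens_antichain:
  assumes sm: "semimodule (num_semigroup \<alpha> \<beta>) \<Delta>"
    and x: "x \<in> min_gens (num_semigroup \<alpha> \<beta>) \<Delta>" and y: "y \<in> min_gens (num_semigroup \<alpha> \<beta>) \<Delta>"
    and g: "g \<in> num_semigroup \<alpha> \<beta>" and eq: "y = x + g"
  shows "y = x"
proof (rule ccontr)
  let ?\<Gamma> = "num_semigroup \<alpha> \<beta>"
  define E where "E = min_gens ?\<Gamma> \<Delta>"
  assume "y \<noteq> x"
  have min: "minimal_generating_system ?\<Gamma> \<Delta> E"
    using minimal_generating_system_min_gens[OF sm] by (simp add: E_def)
  have "translate ?\<Gamma> y \<subseteq> translate ?\<Gamma> x"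
    using eq g add_in_num_semigroup by (fastforce simp: translate_def add.assoc)
  then have "(\<Union>z\<in>E - {y}. translate ?\<Gamma> z) = (\<Union>z\<in>E. translate ?\<Gamma> z)"
    using x \<open>y \<noteq> x\<close> by (auto simp: E_def)
  then have "generating_system ?\<Gamma> \<Delta> (E - {y})"
    using min by (auto simp: minimal_generating_system_def generating_system_def)
  moreover have "E - {y} \<subset> E" using y by (auto simp: E_def)
  ultimately show False using min by (auto simp: minimal_generating_system_def)
qed

lemma semimodule_iso_iff: "semimodule_iso \<Delta> \<Delta>' \<longleftrightarrow> (\<exists>c. (\<lambda>x. x + c) ` int ` \<Delta> = int ` \<Delta>')"
  by (auto simp: semimodule_iso_def bij_betw_def inj_on_def image_image)

section \<open>The lattice of pairs (p, q) and regions bounded by a staircase\<close>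

locale coprime_pair =
  fixes \<alpha> \<beta> :: nat
  assumes \<alpha>_pos: "0 < \<alpha>" and \<beta>_pos: "0 < \<beta>" and cop: "coprime \<alpha> \<beta>"
begin

abbreviation \<Gamma> :: "nat set" where "\<Gamma> \<equiv> num_semigroup \<alpha> \<beta>"

text \<open>The second coordinate is negated so that both coordinates of the corners increase together.\<close>

definition val :: "int \<Rightarrow> int \<Rightarrow> int" where
  "val p q = p * int \<alpha> - q * int \<beta>"

lemma val_add: "val (p + p') (q + q') = val p q + val p' q'"
  by (simp add: val_def algebra_simps)

lemma val_periodic: "val (p + k * int \<beta>) (q + k * int \<alpha>) = val p q"
  by (simp add: val_def algebra_simps)

text \<open>By coprimality the kernel of \<open>val\<close> is generated by (\<beta>, \<alpha>).
  Equations between integers therefore lift to the lattice up to multiples of this vector.\<close>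

lemma val_eqD:
  assumes "val p q = val p' q'"
  obtains k where "p' = p + k * int \<beta>" "q' = q + k * int \<alpha>"
proof -
  have eq: "(p' - p) * int \<alpha> = (q' - q) * int \<beta>"
    using assms by (simp add: val_def algebra_simps)
  have "int \<beta> dvd (p' - p) * int \<alpha>" unfolding eq by simp
  moreover have "coprime (int \<beta>) (int \<alpha>)" using cop by (simp add: coprime_commute)
  ultimately have "int \<beta> dvd p' - p" by (simp add: coprime_dvd_mult_left_iff)
  then obtain k where k: "p' - p = int \<beta> * k" by blast
  then have "(q' - q) * int \<beta> = (k * int \<alpha>) * int \<beta>" using eq by (simp add: algebra_simps)
  then have "q' - q = k * int \<alpha>" using \<beta>_pos by simp
  then show ?thesis using that[of k] k by (simp add: algebra_simps)
qed

lemma val_surj: obtains p q where "c = val p q"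
proof -
  have "coprime (int \<alpha>) (int \<beta>)" using cop by simp
  then obtain u v where "u * int \<alpha> + v * int \<beta> = 1"
    by (metis bezout_int coprime_imp_gcd_eq_1)
  then have "c = c * (u * int \<alpha> + v * int \<beta>)" by simp
  then have "c = val (c * u) (- c * v)" by (simp add: val_def algebra_simps)
  then show ?thesis by (rule that)
qed

lemma mem_\<Gamma>_iff: "g \<in> \<Gamma> \<longleftrightarrow> (\<exists>a b. 0 \<le> a \<and> 0 \<le> b \<and> int g = val a (- b))"
proof
  assume "g \<in> \<Gamma>"
  then obtain a b where "g = a * \<alpha> + b * \<beta>" by (auto simp: num_semigroup_def)
  then have "0 \<le> int a \<and> 0 \<le> int b \<and> int g = val (int a) (- int b)" by (simp add: val_def)
  then show "\<exists>a b. 0 \<le> a \<and> 0 \<le> b \<and> int g = val a (- b)" by blast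
next
  assume "\<exists>a b. 0 \<le> a \<and> 0 \<le> b \<and> int g = val a (- b)"
  then obtain a b where ab: "0 \<le> a" "0 \<le> b" "int g = val a (- b)" by blast
  then have "int g = int (nat a * \<alpha> + nat b * \<beta>)" by (simp add: val_def)
  then have "g = nat a * \<alpha> + nat b * \<beta>" using of_nat_eq_iff by blast
  then show "g \<in> \<Gamma>" unfolding num_semigroup_def by blast
qed

lemma mem_translate_iff:
  "y \<in> translate \<Gamma> x \<longleftrightarrow> (\<exists>a b. 0 \<le> a \<and> 0 \<le> b \<and> int y = int x + val a (- b))"
proof
  assume "y \<in> translate \<Gamma> x"
  then obtain g where "g \<in> \<Gamma>" "y = x + g" by (auto simp: translate_def)
  then show "\<exists>a b. 0 \<le> a \<and> 0 \<le> b \<and> int y = int x + val a (- b)"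
    by (simp add: mem_\<Gamma>_iff)
next
  assume "\<exists>a b. 0 \<le> a \<and> 0 \<le> b \<and> int y = int x + val a (- b)"
  then obtain a b where ab: "0 \<le> a" "0 \<le> b" "int y = int x + val a (- b)" by blast
  then have "0 \<le> val a (- b)" by (simp add: val_def)
  then have "int (y - x) = val a (- b)" "y = x + (y - x)" using ab by simp_all
  then show "y \<in> translate \<Gamma> x" using ab unfolding translate_def mem_\<Gamma>_iff by blast
qed

lemma val_nonneg: "0 \<le> a \<Longrightarrow> 0 \<le> b \<Longrightarrow> 0 \<le> val a (- b)"
  by (simp add: val_def)

text \<open>Adding \<alpha> moves a lattice point right and adding \<beta> moves it down, so a
  corner generates the quadrant to its lower right. The values are kept in \<open>int\<close>
  because an arbitrary staircase can produce negative ones.\<close>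

definition region :: "(int \<Rightarrow> int) \<Rightarrow> (int \<Rightarrow> int) \<Rightarrow> int set" where
  "region H V = {val p q | p q. \<exists>i. H i \<le> p \<and> q \<le> V i}"

lemma region_add_const:
  "region (\<lambda>i. H i + a) (\<lambda>i. V i + b) = (\<lambda>x. x + val a b) ` region H V"
proof (intro equalityI subsetI)
  fix x assume "x \<in> region (\<lambda>i. H i + a) (\<lambda>i. V i + b)"
  then obtain p q i where "x = val p q" "H i + a \<le> p" "q \<le> V i + b" by (auto simp: region_def)
  then have "x = val (p - a) (q - b) + val a b" "H i \<le> p - a" "q - b \<le> V i"
    by (simp_all flip: val_add)
  then show "x \<in> (\<lambda>x. x + val a b) ` region H V" unfolding region_def by blast
next
  fix x assume "x \<in> (\<lambda>x. x + val a b) ` region H V"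
  then obtain p q i where "x = val p q + val a b" "H i \<le> p" "q \<le> V i" by (auto simp: region_def)
  then have "x = val (p + a) (q + b)" "H i + a \<le> p + a" "q + b \<le> V i + b"
    by (simp_all add: val_add)
  then show "x \<in> region (\<lambda>i. H i + a) (\<lambda>i. V i + b)" unfolding region_def by blast
qed

lemma region_shift: "region (\<lambda>i. H (i + k)) (\<lambda>i. V (i + k)) = region H V"
proof -
  have "(\<exists>i. H (i + k) \<le> p \<and> q \<le> V (i + k)) \<longleftrightarrow> (\<exists>i. H i \<le> p \<and> q \<le> V i)" for p q
    by (metis diff_add_cancel)
  then show ?thesis by (simp add: region_def)
qed

lemma region_add:
  assumes "x \<in> region H V" and "0 \<le> a" and "0 \<le> b"
  shows "x + val a (- b) \<in> region H V"
proof -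
  obtain p q i where "x = val p q" "H i \<le> p" "q \<le> V i" using assms by (auto simp: region_def)
  then have "x + val a (- b) = val (p + a) (q - b)" "H i \<le> p + a" "q - b \<le> V i"
    using assms val_add[of p a q "- b"] by simp_all
  then show ?thesis unfolding region_def by blast
qed

text \<open>The definition of \<open>region\<close> only asks for some lattice point with the given
  value. Another such point differs by a multiple of (\<beta>, \<alpha>), which is absorbed by
  moving the corner index by a multiple of \<open>n\<close>.\<close>

lemma val_in_region_iff:
  assumes H: "H \<in> stairs n \<beta>" and V: "V \<in> stairs n \<alpha>"
  shows "val p q \<in> region H V \<longleftrightarrow> (\<exists>i. H i \<le> p \<and> q \<le> V i)"
proof
  assume "val p q \<in> region H V"
  then obtain p' q' i where *: "val p' q' = val p q" "H i \<le> p'" "q' \<le> V i"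
    by (auto simp: region_def)
  then obtain k where k: "p = p' + k * int \<beta>" "q = q' + k * int \<alpha>" by (metis val_eqD)
  then have "H (i + k * int n) \<le> p" "q \<le> V (i + k * int n)"
    using * stairs_add_mult[OF H] stairs_add_mult[OF V] by simp_all
  then show "\<exists>i. H i \<le> p \<and> q \<le> V i" by blast
qed (auto simp: region_def)

lemma region_eqD:
  assumes H: "H \<in> stairs n \<beta>" and V: "V \<in> stairs n \<alpha>"
    and H': "H' \<in> stairs n' \<beta>" and V': "V' \<in> stairs n' \<alpha>"
    and eq: "region H V = region H' V'"
  obtains k where "\<And>i. H' i = H (i + k)" "\<And>i. V' i = V (i + k)"
proof -
  \<comment> \<open>The corners can be read off the region alone.\<close>
  have corner: "(\<exists>i. p = H i \<and> q = V i) \<longleftrightarrow>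
      val p q \<in> region H V \<and> val (p - 1) q \<notin> region H V \<and> val p (q + 1) \<notin> region H V"
    if H: "H \<in> stairs n \<beta>" and V: "V \<in> stairs n \<alpha>" for n H V p q
  proof -
    \<comment> \<open>Since \<open>H\<close> and \<open>V\<close> increase together, no corner lies
      in the quadrant of a different one; hence one step left or up from a corner leaves the
      region.\<close>
    have "\<not> (H j < H i \<and> V i \<le> V j)" "\<not> (H j \<le> H i \<and> V i < V j)" for i j
      using stairs_less_iff[OF H] stairs_le_iff[OF H] stairs_less_iff[OF V] stairs_le_iff[OF V]
      by auto
    then show ?thesis
      unfolding val_in_region_iff[OF H V] by (smt (verit))
  qed
  have same: "(\<exists>i. p = H i \<and> q = V i) \<longleftrightarrow> (\<exists>i. p = H' i \<and> q = V' i)" for p q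
    unfolding corner[OF H V] corner[OF H' V'] eq ..
  then have "range H = range H'" by blast
  then obtain k where k: "\<And>i. H' i = H (i + k)"
    using strict_mono_range_eq_shift H H' stairs_strict_mono by metis
  moreover have "V' i = V (i + k)" for i
  proof -
    obtain j where "H' i = H j" "V' i = V j" using same[of "H' i" "V' i"] by blast
    then show ?thesis using k[of i] stairs_eq_iff[OF H] by simp
  qed
  ultimately show ?thesis by (rule that)
qed

text \<open>After lifting to the lattice, the first coordinates give
  \<open>i + k * n \<le> j\<close> and the second coordinates the reverse inequality. So corners of
  different values are never related by an element of \<Gamma>.\<close>

lemma corner_val_diff:
  assumes H: "H \<in> stairs n \<beta>" and V: "V \<in> stairs n \<alpha>"
    and eq: "val (H j) (V j) = val (H i) (V i) + val a (- b)" and ab: "0 \<le> a" "0 \<le> b"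
  obtains k where "j = i + k * int n"
proof -
  have "val (H i + a) (V i - b) = val (H j) (V j)"
    using eq val_add[of "H i" a "V i" "- b"] by simp
  then obtain k where k: "H j = H i + a + k * int \<beta>" "V j = V i - b + k * int \<alpha>"
    by (rule val_eqD)
  then have "H (i + k * int n) \<le> H j" "V j \<le> V (i + k * int n)"
    using ab stairs_add_mult[OF H] stairs_add_mult[OF V] by simp_all
  then have "j = i + k * int n"
    using stairs_le_iff[OF H] stairs_le_iff[OF V] by simp
  then show ?thesis by (rule that)
qed

lemma corner_val_eq_iff:
  assumes H: "H \<in> stairs n \<beta>" and V: "V \<in> stairs n \<alpha>" and "0 < n"
  shows "val (H j) (V j) = val (H i) (V i) \<longleftrightarrow> j mod int n = i mod int n"
proof
  assume "val (H j) (V j) = val (H i) (V i)"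
  then have "val (H j) (V j) = val (H i) (V i) + val 0 (- 0)" by (simp add: val_def)
  then show "j mod int n = i mod int n"
    using corner_val_diff[OF H V] by (metis mod_mult_self1 order_refl)
next
  assume "j mod int n = i mod int n"
  then obtain k where "j = i + k * int n" by (metis mod_eqE mult.commute)
  then show "val (H j) (V j) = val (H i) (V i)"
    using stairs_add_mult[OF H] stairs_add_mult[OF V] val_periodic by simp
qed

section \<open>Semimodules and their syzygies in terms of staircases\<close>

definition represents :: "nat \<Rightarrow> (int \<Rightarrow> int) \<Rightarrow> (int \<Rightarrow> int) \<Rightarrow> nat set \<Rightarrow> bool" where
  "represents n H V \<Delta> \<longleftrightarrow>
     0 < n \<and> H \<in> stairs n \<beta> \<and> V \<in> stairs n \<alpha> \<and> int ` \<Delta> = region H V"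

lemma represents_semimodule:
  assumes "represents n H V \<Delta>"
  shows "semimodule \<Gamma> \<Delta>"
proof -
  have R: "int ` \<Delta> = region H V" using assms by (simp add: represents_def)
  have "val (H 0) (V 0) \<in> region H V" by (auto simp: region_def)
  then have "\<Delta> \<noteq> {}" using R by auto
  moreover have "x + g \<in> \<Delta>" if "x \<in> \<Delta>" "g \<in> \<Gamma>" for x g
  proof -
    have "int x \<in> region H V" using that R by auto
    then have "int (x + g) \<in> region H V"
      using that(2) region_add by (auto simp: mem_\<Gamma>_iff)
    then show ?thesis using R by (metis image_iff of_nat_eq_iff)
  qed
  ultimately show ?thesis by (simp add: semimodule_def)
qed

lemma represents_corner:
  assumes "represents n H V \<Delta>"
  obtains x where "x \<in> \<Delta>" "int x = val (H i) (V i)"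
proof -
  have "val (H i) (V i) \<in> region H V" by (auto simp: region_def)
  also have "region H V = int ` \<Delta>" using assms by (simp add: represents_def)
  finally show ?thesis using that by (metis imageE)
qed

text \<open>The corners generate the region by construction, and \<open>corner_val_diff\<close>
  makes them an antichain.\<close>

lemma represents_min_gens:
  assumes rep: "represents n H V \<Delta>"
  shows "min_gens \<Gamma> \<Delta> = {x. \<exists>i. int x = val (H i) (V i)}"
proof (rule generating_antichain_eq_min_gens)
  have n: "0 < n" and H: "H \<in> stairs n \<beta>" and V: "V \<in> stairs n \<alpha>" and R: "int ` \<Delta> = region H V"
    using rep by (auto simp: represents_def)
  show sm: "semimodule \<Gamma> \<Delta>" using rep by (rule represents_semimodule)
  have sub: "{x. \<exists>i. int x = val (H i) (V i)} \<subseteq> \<Delta>"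
  proof clarify
    fix x i assume "int x = val (H i) (V i)"
    then show "x \<in> \<Delta>" using represents_corner[OF rep, of i] by (metis of_nat_eq_iff)
  qed
  have "\<exists>x i. int x = val (H i) (V i) \<and> y \<in> translate \<Gamma> x" if "y \<in> \<Delta>" for y
  proof -
    have "int y \<in> region H V" using that R by auto
    then obtain p q i where pq: "int y = val p q" "H i \<le> p" "q \<le> V i" by (auto simp: region_def)
    obtain x where x: "x \<in> \<Delta>" "int x = val (H i) (V i)" using represents_corner[OF rep] by blast
    have eq: "int y = int x + val (p - H i) (- (V i - q))"
      unfolding pq(1) x(2) by (simp flip: val_add)
    moreover have "0 \<le> p - H i" "0 \<le> V i - q" using pq by simp_all
    ultimately have "y \<in> translate \<Gamma> x" unfolding mem_translate_iff by blast
    then show ?thesis using x(2) by blast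
  qed
  moreover have "translate \<Gamma> x \<subseteq> \<Delta>" if "x \<in> \<Delta>" for x
    using sm that by (auto simp: translate_def semimodule_def)
  ultimately have "(\<Union>x\<in>{x. \<exists>i. int x = val (H i) (V i)}. translate \<Gamma> x) = \<Delta>"
    using sub by (auto simp: subset_iff)
  with sub show "generating_system \<Gamma> \<Delta> {x. \<exists>i. int x = val (H i) (V i)}"
    unfolding generating_system_def by simp
  fix x y g
  assume *: "x \<in> {x. \<exists>i. int x = val (H i) (V i)}" "y \<in> {x. \<exists>i. int x = val (H i) (V i)}"
    "g \<in> \<Gamma>" "y = x + g"
  obtain a b where ab: "0 \<le> a" "0 \<le> b" "int g = val a (- b)" using *(3) mem_\<Gamma>_iff by blast
  obtain i j where ij: "int x = val (H i) (V i)" "int y = val (H j) (V j)" using * by blast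
  then have "val (H j) (V j) = val (H i) (V i) + val a (- b)" using *(4) ab by simp
  then obtain k where "j = i + k * int n" using corner_val_diff[OF H V] ab by metis
  then show "y = x" using ij corner_val_eq_iff[OF H V n, of j i] by simp
qed

lemma represents_card_min_gens:
  assumes rep: "represents n H V \<Delta>"
  shows "card (min_gens \<Gamma> \<Delta>) = n"
proof -
  have n: "0 < n" and H: "H \<in> stairs n \<beta>" and V: "V \<in> stairs n \<alpha>"
    using rep by (auto simp: represents_def)
  let ?f = "\<lambda>i. val (H i) (V i)"
  have "int ` min_gens \<Gamma> \<Delta> = ?f ` {0..<int n}"
  proof (intro equalityI subsetI)
    fix x assume "x \<in> int ` min_gens \<Gamma> \<Delta>"
    then obtain i where "x = ?f i" unfolding represents_min_gens[OF rep] by auto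
    then have "x = ?f (i mod int n)" using corner_val_eq_iff[OF H V n, of i "i mod int n"] by simp
    then show "x \<in> ?f ` {0..<int n}" using n by auto
  next
    fix x assume "x \<in> ?f ` {0..<int n}"
    then obtain i where "x = ?f i" by blast
    moreover obtain y where "int y = ?f i" using represents_corner[OF rep] by metis
    ultimately show "x \<in> int ` min_gens \<Gamma> \<Delta>"
      unfolding represents_min_gens[OF rep] by (metis (mono_tags, lifting) image_eqI mem_Collect_eq)
  qed
  moreover have "inj_on ?f {0..<int n}"
    by (auto intro!: inj_onI simp: corner_val_eq_iff[OF H V n])
  ultimately have "card (int ` min_gens \<Gamma> \<Delta>) = n" by (simp add: card_image)
  then show ?thesis by (simp add: card_image)
qed

text \<open>For \<open>i < j\<close> the quadrants of the corners \<open>i\<close> and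
  \<open>j\<close> meet in the quadrant with corner \<open>(H j, V i)\<close>. These are largest for
  \<open>j = i + 1\<close>, so the new corners are \<open>(H (i + 1), V i)\<close>.\<close>

lemma represents_syz:
  assumes rep: "represents n H V \<Delta>" and n2: "2 \<le> n"
  shows "represents n (\<lambda>i. H (i + 1)) V (syz \<Gamma> \<Delta>)"
proof -
  have n: "0 < n" and H: "H \<in> stairs n \<beta>" and V: "V \<in> stairs n \<alpha>" and R: "int ` \<Delta> = region H V"
    using rep by (auto simp: represents_def)
  have "int ` syz \<Gamma> \<Delta> = region (\<lambda>i. H (i + 1)) V"
  proof (intro equalityI subsetI)
    fix z assume "z \<in> int ` syz \<Gamma> \<Delta>"
    then obtain y x x' where y: "z = int y" "x \<in> min_gens \<Gamma> \<Delta>" "x' \<in> min_gens \<Gamma> \<Delta>" "x \<noteq> x'"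
      "y \<in> translate \<Gamma> x" "y \<in> translate \<Gamma> x'" by (auto simp: syz_def)
    obtain i j where ij: "int x = val (H i) (V i)" "int x' = val (H j) (V j)"
      using y unfolding represents_min_gens[OF rep] by blast
    have sum: "val (H i) (V i) + val a (- b) = val (H i + a) (V i - b)" for i a b
      by (simp flip: val_add)
    obtain a b where ab: "0 \<le> a" "0 \<le> b" "z = val (H i + a) (V i - b)"
      using y(1,5) unfolding mem_translate_iff ij sum by blast
    obtain c d where cd: "0 \<le> c" "0 \<le> d" "z = val (H j + c) (V j - d)"
      using y(1,6) unfolding mem_translate_iff ij sum by blast
    have "val (H j + c) (V j - d) = val (H i + a) (V i - b)" using ab cd by simp
    then obtain k where "H i + a = H j + c + k * int \<beta>" "V i - b = V j - d + k * int \<alpha>"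
      by (rule val_eqD)
    then have k: "H i + a = H (j + k * int n) + c" "V i - b = V (j + k * int n) - d"
      using stairs_add_mult[OF H] stairs_add_mult[OF V] by simp_all
    \<comment> \<open>Replacing \<open>j\<close> by an index of the same generator lets both
      quadrants contain the same lattice point, not merely points of equal value.\<close>
    define j' where "j' = j + k * int n"
    have "i \<noteq> j'"
    proof
      assume "i = j'"
      then have "int x = int x'" unfolding ij corner_val_eq_iff[OF H V n] by (simp add: j'_def)
      then show False using y by simp
    qed
    then consider "i + 1 \<le> j'" | "j' + 1 \<le> i" by linarith
    then have "\<exists>t. H (t + 1) \<le> H i + a \<and> V i - b \<le> V t"
    proof cases
      case 1
      then have "H (i + 1) \<le> H j'" using stairs_le_iff[OF H] by simp
      then show ?thesis using k ab cd by (intro exI[of _ i]) (simp add: j'_def)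
    next
      case 2
      then have "H (j' + 1) \<le> H i" using stairs_le_iff[OF H] by simp
      then show ?thesis using k ab cd by (intro exI[of _ j']) (simp add: j'_def)
    qed
    then show "z \<in> region (\<lambda>i. H (i + 1)) V" unfolding ab(3) region_def by blast
  next
    fix z assume "z \<in> region (\<lambda>i. H (i + 1)) V"
    then obtain p q i where pq: "z = val p q" "H (i + 1) \<le> p" "q \<le> V i" by (auto simp: region_def)
    have mono: "H i \<le> H (i + 1)" "V i \<le> V (i + 1)"
      using stairs_le_iff[OF H] stairs_le_iff[OF V] by simp_all
    have "z \<in> region H V" using pq mono unfolding region_def by fastforce
    then obtain y where y: "z = int y" using R by (metis imageE)
    obtain x where x: "int x = val (H i) (V i)" using represents_corner[OF rep] by metis
    obtain x' where x': "int x' = val (H (i + 1)) (V (i + 1))" using represents_corner[OF rep] by metis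
    \<comment> \<open>Here \<open>2 \<le> n\<close> enters: for a single generator, neighbouring
      corners would have the same value.\<close>
    have "int n \<noteq> 1" "0 < int n" using n2 by auto
    then have "i mod int n \<noteq> (i + 1) mod int n"
      by (metis add_diff_cancel_left' mod_eq_dvd_iff zdvd1_eq abs_of_pos)
    then have "int x \<noteq> int x'" unfolding x x' using corner_val_eq_iff[OF H V n] by metis
    then have "x \<noteq> x'" by simp
    moreover have "x \<in> min_gens \<Gamma> \<Delta>" "x' \<in> min_gens \<Gamma> \<Delta>"
      using x x' unfolding represents_min_gens[OF rep] by blast+
    moreover have "y \<in> translate \<Gamma> x" unfolding mem_translate_iff
      by (intro exI[of _ "p - H i"] exI[of _ "V i - q"])
         (use pq mono x y in \<open>simp flip: val_add\<close>)
    moreover have "y \<in> translate \<Gamma> x'" unfolding mem_translate_iff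
      by (intro exI[of _ "p - H (i + 1)"] exI[of _ "V (i + 1) - q"])
         (use pq mono x' y in \<open>simp flip: val_add\<close>)
    ultimately show "z \<in> int ` syz \<Gamma> \<Delta>" unfolding y syz_def by blast
  qed
  then show ?thesis
    using n V stairs_shift[OF H, of 1 0] by (simp add: represents_def)
qed

lemma represents_syz_funpow:
  assumes "represents n H V \<Delta>" and "2 \<le> n"
  shows "represents n (\<lambda>i. H (i + int l)) V ((syz \<Gamma> ^^ l) \<Delta>)"
proof (induction l)
  case 0
  then show ?case using assms by simp
next
  case (Suc l)
  from represents_syz[OF Suc assms(2)] show ?case by (simp add: algebra_simps)
qed

text \<open>A translation of the integers lifts by \<open>val_surj\<close> to a lattice translation,
  which supplies \<open>a\<close> and \<open>b\<close>. By \<open>region_eqD\<close> the only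
  remaining freedom is the index shift \<open>k\<close>.\<close>

lemma represents_iso_iff:
  assumes rep: "represents n H V \<Delta>" and rep': "represents n' H' V' \<Delta>'"
  shows "semimodule_iso \<Delta> \<Delta>' \<longleftrightarrow>
    (\<exists>k a b. (\<forall>i. H' i = H (i + k) + a) \<and> (\<forall>i. V' i = V (i + k) + b))"
proof
  assume "semimodule_iso \<Delta> \<Delta>'"
  then obtain c where "(\<lambda>x. x + c) ` region H V = region H' V'"
    using rep rep' by (auto simp: semimodule_iso_iff represents_def)
  moreover obtain a b where "c = val a b" by (rule val_surj)
  ultimately have eq: "region (\<lambda>i. H i + a) (\<lambda>i. V i + b) = region H' V'"
    by (simp add: region_add_const)
  have "(\<lambda>i. H i + a) \<in> stairs n \<beta>" "(\<lambda>i. V i + b) \<in> stairs n \<alpha>"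
    using rep stairs_shift[of H n \<beta> 0 a] stairs_shift[of V n \<alpha> 0 b] by (simp_all add: represents_def)
  then show "\<exists>k a b. (\<forall>i. H' i = H (i + k) + a) \<and> (\<forall>i. V' i = V (i + k) + b)"
    using region_eqD[OF _ _ _ _ eq] rep' unfolding represents_def by metis
next
  assume "\<exists>k a b. (\<forall>i. H' i = H (i + k) + a) \<and> (\<forall>i. V' i = V (i + k) + b)"
  then obtain k a b where "H' = (\<lambda>i. H (i + k) + a)" "V' = (\<lambda>i. V (i + k) + b)" by blast
  then have "region H' V' = (\<lambda>x. x + val a b) ` region H V"
    by (simp add: region_add_const region_shift)
  then show "semimodule_iso \<Delta> \<Delta>'"
    using rep rep' by (auto simp: semimodule_iso_iff represents_def)
qed

text \<open>The minimal generators are lifted to all lattice points with these values. By minimality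
  the lifts form an increasing chain, so the first coordinates can be enumerated as \<open>H\<close>
  and determine the second coordinates \<open>V\<close>.\<close>

lemma semimodule_represented:
  assumes sm: "semimodule \<Gamma> \<Delta>"
  obtains n H V where "represents n H V \<Delta>"
proof -
  define E where "E = min_gens \<Gamma> \<Delta>"
  have gen: "generating_system \<Gamma> \<Delta> E"
    using minimal_generating_system_min_gens[OF sm]
    by (simp add: E_def minimal_generating_system_def)
  define S where "S p q \<longleftrightarrow> val p q \<in> int ` E" for p q
  have S_per: "S (p + k * int \<beta>) (q + k * int \<alpha>) \<longleftrightarrow> S p q" for p q k
    by (simp add: S_def val_periodic)
  \<comment> \<open>A lift to the lower right of another differs from it by an element of \<Gamma>,
    so both lift the same generator; positivity of \<alpha> and \<beta> then makes the two points
    equal.\<close>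
  have chain: "p = p' \<and> q = q'" if "S p q" "S p' q'" "p \<le> p'" "q' \<le> q" for p q p' q'
  proof -
    obtain x y where xy: "x \<in> E" "y \<in> E" "val p q = int x" "val p' q' = int y"
      using \<open>S p q\<close> \<open>S p' q'\<close> unfolding S_def by (metis imageE)
    have eq: "int y = int x + val (p' - p) (- (q - q'))"
      unfolding xy(3,4)[symmetric] by (simp flip: val_add)
    moreover have "0 \<le> p' - p" "0 \<le> q - q'" using that by simp_all
    ultimately have "y \<in> translate \<Gamma> x" unfolding mem_translate_iff by blast
    then have "y = x"
      using min_gens_antichain[OF sm, of x y] xy by (auto simp: E_def translate_def)
    then have "(p' - p) * int \<alpha> + (q - q') * int \<beta> = 0" using eq by (simp add: val_def algebra_simps)
    moreover have "0 \<le> (p' - p) * int \<alpha>" "0 \<le> (q - q') * int \<beta>" using that by simp_all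
    ultimately have "(p' - p) * int \<alpha> = 0" "(q - q') * int \<beta> = 0" by linarith+
    then show ?thesis using \<alpha>_pos \<beta>_pos by simp
  qed
  define P where "P = {p. \<exists>q. S p q}"
  have "P \<noteq> {}"
  proof -
    have "E \<noteq> {}" using gen sm by (auto simp: generating_system_def semimodule_def)
    then obtain x where "x \<in> E" by blast
    moreover obtain p q where "int x = val p q" by (rule val_surj)
    ultimately show ?thesis by (force simp: P_def S_def)
  qed
  moreover have "p + k * int \<beta> \<in> P" if "p \<in> P" for p k
    using that S_per unfolding P_def by blast
  ultimately obtain n H where n: "0 < n" and H: "H \<in> stairs n \<beta>" and range: "range H = P"
    using periodic_set_enumeration[OF \<beta>_pos] by metis
  have "\<forall>i. \<exists>q. S (H i) q" using range P_def by blast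
  then obtain V where V: "\<And>i. S (H i) (V i)" by metis
  \<comment> \<open>Two lifts in one column are always comparable, so \<open>chain\<close> leaves
    only one.\<close>
  have V_unique: "q = V i" if "S (H i) q" for i q
    using chain[OF that V[of i]] chain[OF V[of i] that] by (cases "q \<le> V i") auto
  have "strict_mono V"
  proof (rule strict_monoI)
    fix i j :: int assume "i < j"
    then have "H i < H j" using stairs_less_iff[OF H] by simp
    then show "V i < V j" using chain[OF V V, of i j] by force
  qed
  moreover have "V (i + int n) = V i + int \<alpha>" for i
  proof -
    have "S (H i + 1 * int \<beta>) (V i + 1 * int \<alpha>)" using V[of i] S_per by blast
    moreover have "H (i + int n) = H i + int \<beta>" using stairs_add_mult[OF H, of i 1] by simp
    ultimately show ?thesis using V_unique[of "i + int n" "V i + int \<alpha>"] by simp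
  qed
  ultimately have Vs: "V \<in> stairs n \<alpha>" by (simp add: stairs_def)
  have "int ` \<Delta> = region H V"
  proof (intro equalityI subsetI)
    fix z assume "z \<in> int ` \<Delta>"
    then obtain x g where xg: "x \<in> E" "g \<in> \<Gamma>" "z = int (x + g)"
      using gen by (auto simp: generating_system_def translate_def)
    obtain p q where pq: "int x = val p q" by (rule val_surj)
    then have "S p q" using xg by (force simp: S_def)
    then obtain i where "p = H i" using range P_def by blast
    then have "int x \<in> region H V" using V_unique \<open>S p q\<close> pq by (force simp: region_def)
    then show "z \<in> region H V" using xg region_add by (auto simp: mem_\<Gamma>_iff)
  next
    fix z assume "z \<in> region H V"
    then obtain p q i where pq: "z = val p q" "H i \<le> p" "q \<le> V i" by (auto simp: region_def)
    obtain x where x: "x \<in> E" "val (H i) (V i) = int x" using V[of i] by (auto simp: S_def)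
    have eq: "z = int x + val (p - H i) (- (V i - q))"
      unfolding pq(1) x(2)[symmetric] by (simp flip: val_add)
    have nn: "0 \<le> p - H i" "0 \<le> V i - q" using pq by simp_all
    then have "0 \<le> val (p - H i) (- (V i - q))" by (rule val_nonneg)
    then obtain g where g: "int g = val (p - H i) (- (V i - q))" by (metis nonneg_int_cases)
    then have "g \<in> \<Gamma>" using nn unfolding mem_\<Gamma>_iff by blast
    moreover have "x \<in> \<Delta>" using gen x by (auto simp: generating_system_def)
    ultimately have "x + g \<in> \<Delta>" using sm by (simp add: semimodule_def)
    moreover have "z = int (x + g)" using eq g by simp
    ultimately show "z \<in> int ` \<Delta>" by blast
  qed
  then show ?thesis using that n H Vs by (auto simp: represents_def)
qed

text \<open>Shifting \<open>H\<close> by \<open>a\<close> translates the region by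
  \<open>val a 0\<close>. By periodicity, values need to be bounded below only on the quadrants of
  corners with index in \<open>[0, n)\<close>.\<close>

lemma represents_exists:
  assumes n: "0 < n" and H: "H \<in> stairs n \<beta>" and V: "V \<in> stairs n \<alpha>"
  obtains a \<Delta> where "represents n (\<lambda>i. H i + a) V \<Delta>"
proof -
  \<comment> \<open>On those quadrants this \<open>a\<close> yields
    \<open>p \<ge> |V n| * \<beta>\<close> and \<open>q \<le> |V n|\<close>, whence
    \<open>p * \<alpha> \<ge> q * \<beta>\<close> because \<open>\<alpha> \<ge> 1\<close>.\<close>
  define a where "a = \<bar>H 0\<bar> + \<bar>V (int n)\<bar> * int \<beta>"
  have "0 \<le> val p q" if "H i + a \<le> p" "q \<le> V i" for p q i
  proof -
    define k where "k = - (i div int n)"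
    define r where "r = i + k * int n"
    have r: "0 \<le> r" "r < int n"
    proof -
      have "r = i mod int n"
        using minus_mult_div_eq_mod[of i "int n"] by (simp add: r_def k_def algebra_simps)
      then show "0 \<le> r" "r < int n" using n by simp_all
    qed
    have "H 0 \<le> H r" "V r \<le> V (int n)" using r stairs_le_iff[OF H] stairs_le_iff[OF V] by simp_all
    then have "H 0 + a \<le> p + k * int \<beta>" "q + k * int \<alpha> \<le> V (int n)"
      using that stairs_add_mult[OF H, of i k] stairs_add_mult[OF V, of i k] by (simp_all add: r_def)
    then have 1: "\<bar>V (int n)\<bar> * int \<beta> \<le> p + k * int \<beta>" and 2: "q + k * int \<alpha> \<le> \<bar>V (int n)\<bar>"
      by (simp_all add: a_def)
    have "0 \<le> p + k * int \<beta>" using 1 by (meson abs_ge_zero mult_nonneg_nonneg of_nat_0_le_iff order_trans)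
    then have "(p + k * int \<beta>) * 1 \<le> (p + k * int \<beta>) * int \<alpha>"
      using \<alpha>_pos by (intro mult_left_mono) auto
    moreover have "(q + k * int \<alpha>) * int \<beta> \<le> \<bar>V (int n)\<bar> * int \<beta>"
      using 2 by (intro mult_right_mono) auto
    ultimately have "0 \<le> val (p + k * int \<beta>) (q + k * int \<alpha>)"
      using 1 unfolding val_def diff_ge_0_iff_ge mult_1_right by (meson order_trans)
    then show ?thesis by (simp only: val_periodic)
  qed
  then have "int ` nat ` region (\<lambda>i. H i + a) V = region (\<lambda>i. H i + a) V"
    by (force simp: region_def image_image)
  moreover have "(\<lambda>i. H i + a) \<in> stairs n \<beta>" using stairs_shift[OF H, of 0 a] by simp
  ultimately show ?thesis using that n V by (simp add: represents_def)
qed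

end

subsection \<open>Periods and counting\<close>

text \<open>These are the periods of the sequence of increments; the constant \<open>c\<close>
  absorbs the growth of \<open>H\<close>. They form a subgroup of the integers, hence the closure
  under gcd.\<close>

definition periods :: "(int \<Rightarrow> int) \<Rightarrow> int set" where
  "periods H = {k. \<exists>c. \<forall>i. H (i + k) = H i + c}"

lemma periods_mult_value:
  assumes "k \<in> periods H"
  shows "H (i + c * k) = H i + c * (H k - H 0)"
proof -
  obtain d where d: "\<And>i. H (i + k) = H i + d" using assms by (auto simp: periods_def)
  have d': "d = H k - H 0" using d[of 0] by simp
  show ?thesis
  proof (induction c rule: int_induct[of _ 0])
    case base
    show ?case by simp
  next
    case (step1 c)
    have "H (i + (c + 1) * k) = H (i + c * k + k)" by (simp add: algebra_simps)
    then show ?case using step1 d[of "i + c * k"] d' by (simp add: algebra_simps)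
  next
    case (step2 c)
    have "H (i + c * k) = H (i + (c - 1) * k + k)" by (simp add: algebra_simps)
    then show ?case using step2 d[of "i + (c - 1) * k"] d' by (simp add: algebra_simps)
  qed
qed

lemma periods_mult:
  assumes "k \<in> periods H"
  shows "c * k \<in> periods H"
proof -
  have "\<forall>i. H (i + c * k) = H i + c * (H k - H 0)" using periods_mult_value[OF assms] by blast
  then show ?thesis unfolding periods_def by blast
qed

lemma periods_add: "j \<in> periods H \<Longrightarrow> k \<in> periods H \<Longrightarrow> j + k \<in> periods H"
proof -
  assume "j \<in> periods H" "k \<in> periods H"
  then obtain c d where "\<And>i. H (i + j) = H i + c" "\<And>i. H (i + k) = H i + d"
    by (auto simp: periods_def)
  then have "H (i + (j + k)) = H i + (c + d)" for i by (metis add.assoc)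
  then show "j + k \<in> periods H" by (auto simp: periods_def)
qed

lemma periods_gcd:
  assumes "j \<in> periods H" and "k \<in> periods H"
  shows "gcd j k \<in> periods H"
proof -
  obtain u v where "u * j + v * k = gcd j k" using bezout_int by blast
  then show ?thesis using assms periods_add periods_mult by metis
qed

lemma stairs_period: "H \<in> stairs n s \<Longrightarrow> int n \<in> periods H"
  by (auto simp: stairs_def periods_def)

text \<open>The increments over one period \<open>n\<close> consist of \<open>A\<close> equal blocks
  of length \<open>p\<close>, and their total is \<open>s\<close>.\<close>

lemma stairs_period_dvd:
  assumes H: "H \<in> stairs n s" and p: "int p \<in> periods H" and n: "n = A * p"
  shows "A dvd s"
proof -
  have "H 0 + int s = H (0 + int n)" using stairs_add_mult[OF H, of 0 1] by simp
  also have "\<dots> = H 0 + int A * (H (int p) - H 0)"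
    using periods_mult_value[OF p, of 0 "int A"] n by simp
  finally have "int A dvd int s" by simp
  then show ?thesis by simp
qed

text \<open>A staircase made of \<open>d\<close> equal blocks is determined by one block. This
  reduces counting with an extra period to \<open>card_stairs0\<close> with smaller
  parameters.\<close>

lemma stairs0_subperiod:
  assumes n: "0 < n" and dn: "d dvd n" and ds: "d dvd s"
  shows "{H \<in> stairs0 n s. int (n div d) \<in> periods H} = stairs0 (n div d) (s div d)"
proof (intro equalityI subsetI)
  define p where "p = n div d"
  have np: "n = d * p" using dn by (simp add: p_def)
  then have d: "0 < d" using n by (cases d) auto
  fix H assume "H \<in> {H \<in> stairs0 n s. int (n div d) \<in> periods H}"
  then have H: "H \<in> stairs n s" "H 0 = 0" "int p \<in> periods H" by (auto simp: p_def stairs0_def)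
  have "H (int n) = int d * H (int p)"
    using periods_mult_value[OF H(3), of 0 "int d"] H(2) np by simp
  moreover have "H (int n) = int d * int (s div d)"
    using stairs_add_mult[OF H(1), of 0 1] H(2) ds by (simp flip: of_nat_mult)
  ultimately have "H (int p) = int (s div d)" using d by simp
  then have "H (i + int p) = H i + int (s div d)" for i
    using periods_mult_value[OF H(3), of i 1] H(2) by simp
  then show "H \<in> stairs0 (n div d) (s div d)"
    using H by (simp add: stairs0_def stairs_def p_def)
next
  fix H assume "H \<in> stairs0 (n div d) (s div d)"
  then have H: "H \<in> stairs (n div d) (s div d)" "H 0 = 0" by (auto simp: stairs0_def)
  have "H (i + int d * int (n div d)) = H i + int d * int (s div d)" for i
    by (rule stairs_add_mult[OF H(1)])
  then have "H (i + int n) = H i + int s" for i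
    using dn ds by (simp flip: of_nat_mult)
  then show "H \<in> {H \<in> stairs0 n s. int (n div d) \<in> periods H}"
    using H stairs_period[OF H(1)] by (simp add: stairs0_def stairs_def)
qed

text \<open>Writing \<open>n = A * B * w\<close> gives \<open>p = B * w\<close> and
  \<open>q = A * w\<close>, so \<open>w\<close> divides \<open>gcd p q\<close> and thus
  \<open>l\<close>. Cancelling \<open>w\<close> in \<open>A * B * w = l * m\<close> leaves
  \<open>m\<close> as a divisor of \<open>A * B\<close>.\<close>

lemma coprime_cofactors_dvd:
  fixes n p q l m A B :: nat
  assumes n: "0 < n" and nA: "n = A * p" and nB: "n = B * q" and cop: "coprime A B"
    and gl: "gcd p q dvd l" and lm: "n = l * m"
  shows "m dvd A * B"
proof -
  have "A dvd n" using nA by simp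
  moreover have "B dvd n" using nB by simp
  ultimately have "A * B dvd n" using cop by (rule divides_mult)
  then obtain w where w: "n = A * B * w" by blast
  have "A > 0" "B > 0" using n nA nB by (auto intro: Nat.gr0I)
  then have "p = B * w" "q = A * w" using w nA nB by (simp_all add: ac_simps)
  then have "w dvd l" using gl by (metis dvd_trans dvd_triv_right gcd_greatest)
  then obtain l' where l': "l = w * l'" by blast
  have "w * (A * B) = n" using w by (simp only: mult.commute)
  also have "n = w * (l' * m)" using lm l' by (simp only: mult.assoc)
  finally have "w * (A * B) = w * (l' * m)" .
  moreover have "0 < w" using w n by (auto intro: Nat.gr0I)
  ultimately have "A * B = l' * m" by simp
  then show ?thesis by simp
qed

text \<open>The gcd of a period with \<open>n\<close> is again a period, and it cuts the
  \<open>n\<close> increments into \<open>A\<close> equal blocks.\<close>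

lemma period_cofactor:
  assumes H: "H \<in> stairs n s" and n: "0 < n" and k: "k \<in> periods H"
  obtains A p where "n = A * p" "int p = gcd (int n) k" "int p \<in> periods H" "A dvd s"
proof -
  define p where "p = nat (gcd (int n) k)"
  have p: "int p = gcd (int n) k" by (simp add: p_def)
  then have "int p dvd int n" by simp
  then obtain A where A: "n = A * p" by (metis dvd_def int_dvd_int_iff mult.commute)
  have "int p \<in> periods H" using periods_gcd[OF stairs_period[OF H] k] p by simp
  then show ?thesis using that A p stairs_period_dvd[OF H _ A] by blast
qed

lemma gcd_period:
  assumes "int p \<in> periods H" and n: "n = A * p" and g: "g dvd A" "0 < n"
  shows "int (n div g) \<in> periods H"
proof -
  obtain c where c: "A = g * c" using g by blast
  then have "n div g = c * p" using n g(2) by (cases "g = 0") auto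
  then show ?thesis using periods_mult[OF assms(1), of "int c"] by simp
qed

lemma gcd_mult_gcd_coprime:
  fixes m a b :: nat
  assumes "coprime a b" and "m dvd a * b"
  shows "gcd m b * gcd m a = m"
proof (rule dvd_antisym)
  have "coprime (gcd m b) (gcd m a)" using assms(1)
    by (meson coprime_divisors coprime_commute gcd_dvd2)
  then show "gcd m b * gcd m a dvd m" by (simp add: divides_mult)
  obtain x y where "m = x * y" "x dvd a" "y dvd b" using division_decomp[OF assms(2)] by blast
  then show "m dvd gcd m b * gcd m a"
    by (metis dvd_triv_left dvd_triv_right gcd_greatest mult.commute mult_dvd_mono)
qed

text \<open>For the forward direction, \<open>H\<close> splits into \<open>A\<close> equal blocks of
  length \<open>p\<close> and \<open>V\<close> into \<open>B\<close> of length \<open>q\<close>,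
  where \<open>gcd p q\<close> divides both \<open>k\<close> and \<open>k + l\<close>, hence
  \<open>l\<close>. So \<open>m\<close> divides \<open>A * B\<close>, and coprimality distributes
  its two factors to \<open>A\<close> and \<open>B\<close>. The converse is a Bezout
  argument.\<close>

lemma common_shift_iff:
  assumes cop: "coprime \<alpha> \<beta>" and H: "H \<in> stairs n \<beta>" and V: "V \<in> stairs n \<alpha>"
    and n: "0 < n" and lm: "n = l * m"
  shows "(\<exists>k. k + int l \<in> periods H \<and> k \<in> periods V) \<longleftrightarrow>
    m dvd \<alpha> * \<beta> \<and> int (n div gcd m \<beta>) \<in> periods H \<and> int (n div gcd m \<alpha>) \<in> periods V"
proof
  assume "\<exists>k. k + int l \<in> periods H \<and> k \<in> periods V"
  then obtain k where k: "k + int l \<in> periods H" "k \<in> periods V" by blast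
  obtain A p where A: "n = A * p" "int p = gcd (int n) (k + int l)" "int p \<in> periods H" "A dvd \<beta>"
    by (rule period_cofactor[OF H n k(1)])
  obtain B q where B: "n = B * q" "int q = gcd (int n) k" "int q \<in> periods V" "B dvd \<alpha>"
    by (rule period_cofactor[OF V n k(2)])
  have copAB: "coprime A B" using cop A(4) B(4) by (meson coprime_divisors coprime_commute)
  have "int (gcd p q) dvd int p" "int (gcd p q) dvd int q"
    unfolding int_dvd_int_iff by simp_all
  then have "int (gcd p q) dvd k + int l" "int (gcd p q) dvd k"
    using A(2) B(2) by (metis dvd_trans gcd_dvd2)+
  then have "int (gcd p q) dvd int l" by (simp add: dvd_add_right_iff)
  then have m: "m dvd A * B"
    using coprime_cofactors_dvd[OF n A(1) B(1) copAB _ lm] by simp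
  \<comment> \<open>\<open>B\<close> divides \<alpha> and is thus coprime to
    \<open>gcd m \<beta>\<close>, which must then divide \<open>A\<close>; symmetrically for
    \<open>gcd m \<alpha>\<close> and \<open>B\<close>.\<close>
  have "coprime (gcd m \<beta>) B" "coprime (gcd m \<alpha>) A"
    using cop A(4) B(4) by (meson coprime_divisors coprime_commute gcd_dvd2)+
  moreover have "gcd m \<beta> dvd A * B" "gcd m \<alpha> dvd A * B" using m by (meson dvd_trans gcd_dvd1)+
  ultimately have "gcd m \<beta> dvd A" "gcd m \<alpha> dvd B"
    by (simp_all add: coprime_dvd_mult_left_iff coprime_dvd_mult_right_iff)
  moreover have "m dvd \<alpha> * \<beta>"
    using m A(4) B(4) by (metis dvd_trans mult.commute mult_dvd_mono)
  ultimately show "m dvd \<alpha> * \<beta> \<and> int (n div gcd m \<beta>) \<in> periods H \<and> int (n div gcd m \<alpha>) \<in> periods V"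
    using gcd_period A B n by metis
next
  assume "m dvd \<alpha> * \<beta> \<and> int (n div gcd m \<beta>) \<in> periods H \<and> int (n div gcd m \<alpha>) \<in> periods V"
  then have m: "m dvd \<alpha> * \<beta>" and pH: "int (n div gcd m \<beta>) \<in> periods H"
    and pV: "int (n div gcd m \<alpha>) \<in> periods V" by auto
  define d e where "d = gcd m \<beta>" and "e = gcd m \<alpha>"
  have de: "d * e = m" unfolding d_def e_def by (rule gcd_mult_gcd_coprime[OF cop m])
  have "0 < d * e" using de lm n by (auto intro: Nat.gr0I)
  then have "n div d = l * e" "n div e = l * d" unfolding lm de[symmetric] by auto
  then have pe: "int l * int e \<in> periods H" and pd: "int l * int d \<in> periods V"
    using pH pV by (simp_all add: d_def e_def)
  have "coprime (int d) (int e)"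
    using cop unfolding d_def e_def by (meson coprime_int_iff coprime_divisors coprime_commute gcd_dvd2)
  then obtain u v where uv: "u * int e + v * int d = 1"
    by (metis bezout_int coprime_commute coprime_imp_gcd_eq_1)
  \<comment> \<open>The witness is \<open>k = - v * l * d\<close>, a multiple of the period
    \<open>l * d\<close> of \<open>V\<close>; the Bezout identity turns \<open>k + l\<close> into
    \<open>u * l * e\<close>, a multiple of the period \<open>l * e\<close> of
    \<open>H\<close>.\<close>
  have "- v * (int l * int d) + int l = int l * (1 - v * int d)" by (simp add: algebra_simps)
  also have "1 - v * int d = u * int e" using uv by simp
  also have "int l * (u * int e) = u * (int l * int e)" by simp
  finally have "- v * (int l * int d) + int l \<in> periods H" using periods_mult[OF pe] by metis
  then show "\<exists>k. k + int l \<in> periods H \<and> k \<in> periods V" using periods_mult[OF pd] by blast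
qed

text \<open>A common period cuts \<open>H\<close> and \<open>V\<close> into the same number
  \<open>A\<close> of equal blocks, so \<open>A\<close> divides both \<beta> and \<alpha> and equals
  1. This is what makes rotation act freely on pairs.\<close>

lemma common_period_dvd:
  assumes cop: "coprime \<alpha> \<beta>" and H: "H \<in> stairs n \<beta>" and V: "V \<in> stairs n \<alpha>"
    and n: "0 < n" and k: "k \<in> periods H" "k \<in> periods V"
  shows "int n dvd k"
proof -
  obtain A p where A: "n = A * p" "int p = gcd (int n) k" "int p \<in> periods H" "A dvd \<beta>"
    by (rule period_cofactor[OF H n k(1)])
  have "int p \<in> periods V" using periods_gcd[OF stairs_period[OF V] k(2)] unfolding A(2) .
  then have "A dvd \<alpha>" using stairs_period_dvd[OF V _ A(1)] by simp
  then have "A = 1" using A(4) cop by (metis coprime_common_divisor nat_dvd_1_iff_1)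
  then show ?thesis using A by (metis gcd_dvd2 mult_1)
qed

section \<open>Rotation of normalised staircases\<close>

definition rot :: "int \<Rightarrow> (int \<Rightarrow> int) \<Rightarrow> int \<Rightarrow> int" where
  "rot k H = (\<lambda>i. H (i + k) - H k)"

lemma rot_stairs0: "H \<in> stairs n s \<Longrightarrow> rot k H \<in> stairs0 n s"
  using stairs_shift[of H n s k "- H k"]
  by (simp add: stairs0_def rot_def)

lemma periods_rot: "periods (rot k H) = periods H"
proof -
  have "(\<forall>i. H (i + j + k) - H k = H (i + k) - H k + c) \<longleftrightarrow> (\<forall>i. H (i + j) = H i + c)" for j c
  proof
    assume *: "\<forall>i. H (i + j + k) - H k = H (i + k) - H k + c"
    show "\<forall>i. H (i + j) = H i + c"
    proof
      fix i
      show "H (i + j) = H i + c" using *[rule_format, of "i - k"] by (simp add: algebra_simps)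
    qed
  next
    assume *: "\<forall>i. H (i + j) = H i + c"
    show "\<forall>i. H (i + j + k) - H k = H (i + k) - H k + c"
    proof
      fix i
      show "H (i + j + k) - H k = H (i + k) - H k + c"
        using *[rule_format, of "i + k"] by (simp add: algebra_simps)
    qed
  qed
  then show ?thesis by (simp add: periods_def rot_def)
qed

lemma rot_eq_imp_period:
  assumes "rot j H = rot k H"
  shows "j - k \<in> periods H"
proof -
  have "H (i + (j - k)) = H i + (H j - H k)" for i
    using fun_cong[OF assms, of "i - k"] by (simp add: rot_def algebra_simps)
  then show ?thesis unfolding periods_def by blast
qed

lemma rot_mod:
  assumes H: "H \<in> stairs n s"
  shows "rot (k mod int n) H = rot k H"
proof -
  have k: "k mod int n + (k div int n) * int n = k" by simp
  have "H (i + k) = H (i + k mod int n) + (k div int n) * int s" for i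
    using stairs_add_mult[OF H, of "i + k mod int n" "k div int n"] k by (simp add: add.assoc)
  from this[of 0] this show ?thesis by (auto simp: rot_def)
qed

lemma card_eq_mult_card_image:
  assumes "finite X" and "\<And>y. y \<in> f ` X \<Longrightarrow> card {x \<in> X. f x = y} = n"
  shows "card X = n * card (f ` X)"
proof -
  have "card X = (\<Sum>x\<in>X. 1)" by simp
  also have "\<dots> = (\<Sum>y\<in>f ` X. \<Sum>x\<in>{x \<in> X. f x = y}. 1)" by (rule sum.image_gen[OF assms(1)])
  also have "\<dots> = (\<Sum>y\<in>f ` X. n)" using assms(2) by (intro sum.cong) auto
  finally show ?thesis by simp
qed

context coprime_pair
begin

text \<open>Collecting all translates that consist of natural numbers gives a normalised pair a
  class even if its own region contains negative integers.\<close>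

definition stairs_class :: "(int \<Rightarrow> int) \<times> (int \<Rightarrow> int) \<Rightarrow> nat set set" where
  "stairs_class = (\<lambda>(H, V). {\<Delta>. \<exists>c. int ` \<Delta> = (\<lambda>x. x + c) ` region H V})"

lemma represents_class:
  assumes rep: "represents n H V \<Delta>"
  shows "iso_rel \<Gamma> `` {\<Delta>} = stairs_class (H, V)"
proof (intro equalityI subsetI)
  have R: "int ` \<Delta> = region H V" using rep by (simp add: represents_def)
  {
    fix \<Delta>' assume "\<Delta>' \<in> iso_rel \<Gamma> `` {\<Delta>}"
    then have "semimodule_iso \<Delta> \<Delta>'" by (simp add: iso_rel_def)
    then obtain c where "(\<lambda>x. x + c) ` region H V = int ` \<Delta>'"
      unfolding semimodule_iso_iff R by blast
    then show "\<Delta>' \<in> stairs_class (H, V)" unfolding stairs_class_def by force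
  }
  fix \<Delta>' assume "\<Delta>' \<in> stairs_class (H, V)"
  then obtain c where c: "int ` \<Delta>' = (\<lambda>x. x + c) ` region H V" by (auto simp: stairs_class_def)
  obtain a b where "c = val a b" by (rule val_surj)
  then have "represents n (\<lambda>i. H i + a) (\<lambda>i. V i + b) \<Delta>'"
    using c rep stairs_shift[of H n \<beta> 0 a] stairs_shift[of V n \<alpha> 0 b]
    by (simp add: represents_def region_add_const)
  then have "semimodule \<Gamma> \<Delta>'" by (rule represents_semimodule)
  moreover have "semimodule \<Gamma> \<Delta>" using rep by (rule represents_semimodule)
  moreover have "semimodule_iso \<Delta> \<Delta>'" unfolding semimodule_iso_iff using c R by metis
  ultimately show "\<Delta>' \<in> iso_rel \<Gamma> `` {\<Delta>}" by (simp add: iso_rel_def)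
qed

lemma stairs_class_shift:
  "stairs_class (\<lambda>i. H (i + k) + a, \<lambda>i. V (i + k) + b) = stairs_class (H, V)"
proof -
  have eq: "region (\<lambda>i. H (i + k) + a) (\<lambda>i. V (i + k) + b) = (\<lambda>x. x + val a b) ` region H V"
    by (simp add: region_add_const region_shift)
  have "(\<exists>c. X = (\<lambda>x. x + c) ` (\<lambda>x. x + val a b) ` region H V) \<longleftrightarrow>
      (\<exists>c. X = (\<lambda>x. x + c) ` region H V)" for X
  proof
    assume "\<exists>c. X = (\<lambda>x. x + c) ` (\<lambda>x. x + val a b) ` region H V"
    then show "\<exists>c. X = (\<lambda>x. x + c) ` region H V" by (auto simp: image_image add.assoc)
  next
    assume "\<exists>c. X = (\<lambda>x. x + c) ` region H V"
    then obtain c where "X = (\<lambda>x. x + c) ` region H V" by blast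
    then have "X = (\<lambda>x. x + (c - val a b)) ` (\<lambda>x. x + val a b) ` region H V"
      by (simp add: image_image)
    then show "\<exists>c. X = (\<lambda>x. x + c) ` (\<lambda>x. x + val a b) ` region H V" by blast
  qed
  then show ?thesis by (simp add: stairs_class_def eq)
qed

lemma stairs_class_rot: "stairs_class (rot k H, rot k V) = stairs_class (H, V)"
  using stairs_class_shift[of H k "- H k" V "- V k"]
  by (simp add: rot_def)

text \<open>Both classes contain semimodules, which are then isomorphic.
  \<open>represents_iso_iff\<close> yields an index shift and additive constants, and normalisation
  at 0 fixes the constants.\<close>

lemma stairs_class_eqD:
  assumes n: "0 < n" and H: "H \<in> stairs n \<beta>" and V: "V \<in> stairs n \<alpha>"
    and H': "H' \<in> stairs0 n \<beta>" and V': "V' \<in> stairs0 n \<alpha>"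
    and eq: "stairs_class (H, V) = stairs_class (H', V')"
  obtains k where "H' = rot k H" "V' = rot k V"
proof -
  obtain a \<Delta> where rep: "represents n (\<lambda>i. H i + a) V \<Delta>" using represents_exists[OF n H V] .
  have s': "H' \<in> stairs n \<beta>" "V' \<in> stairs n \<alpha>" "H' 0 = 0" "V' 0 = 0"
    using H' V' by (auto simp: stairs0_def)
  obtain a' \<Delta>' where rep': "represents n (\<lambda>i. H' i + a') V' \<Delta>'"
    using represents_exists[OF n s'(1,2)] .
  have "stairs_class (\<lambda>i. H i + a, V) = stairs_class (\<lambda>i. H' i + a', V')"
    using eq stairs_class_shift[of H 0 a V 0] stairs_class_shift[of H' 0 a' V' 0] by simp
  moreover have "\<Delta>' \<in> stairs_class (\<lambda>i. H' i + a', V')"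
    using rep' by (auto simp: stairs_class_def represents_def intro!: exI[of _ 0])
  ultimately have "\<Delta>' \<in> iso_rel \<Gamma> `` {\<Delta>}" by (simp add: represents_class[OF rep])
  then have "semimodule_iso \<Delta> \<Delta>'" by (simp add: iso_rel_def)
  then obtain k c d where k: "\<And>i. H' i + a' = H (i + k) + a + c" "\<And>i. V' i = V (i + k) + d"
    unfolding represents_iso_iff[OF rep rep'] by blast
  have "H' i = H (i + k) - H k" "V' i = V (i + k) - V k" for i
    using k(1)[of 0] k(1)[of i] k(2)[of 0] k(2)[of i] s' by simp_all
  then show ?thesis using that[of k] by (simp add: rot_def fun_eq_iff)
qed

text \<open>The \<open>l\<close>-th syzygy shifts \<open>H\<close> by \<open>l\<close> and fixes
  \<open>V\<close>, so an isomorphism with index shift \<open>k\<close> compares \<open>H\<close>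
  with its shift by \<open>k + l\<close> and \<open>V\<close> with its shift by
  \<open>k\<close>.\<close>

lemma represents_syz_iso_iff:
  assumes rep: "represents n H V \<Delta>" and n2: "2 \<le> n"
  shows "semimodule_iso ((syz \<Gamma> ^^ l) \<Delta>) \<Delta> \<longleftrightarrow>
    (\<exists>k. k + int l \<in> periods H \<and> k \<in> periods V)"
proof -
  \<comment> \<open>\<open>represents_iso_iff\<close> has the shifted staircase on the right-hand
    side; moving it across only changes the sign of the constant.\<close>
  have neg: "(\<exists>a. \<forall>i. H i = H (i + k) + a) \<longleftrightarrow> k \<in> periods H" for H :: "int \<Rightarrow> int" and k
  proof
    assume "\<exists>a. \<forall>i. H i = H (i + k) + a"
    then obtain a where a: "\<And>i. H i = H (i + k) + a" by blast
    have "H (i + k) = H i + (- a)" for i using a[of i] by linarith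
    then show "k \<in> periods H" unfolding periods_def by blast
  next
    assume "k \<in> periods H"
    then obtain a where a: "\<And>i. H (i + k) = H i + a" by (auto simp: periods_def)
    have "H i = H (i + k) + (- a)" for i using a[of i] by linarith
    then show "\<exists>a. \<forall>i. H i = H (i + k) + a" by blast
  qed
  have "semimodule_iso ((syz \<Gamma> ^^ l) \<Delta>) \<Delta> \<longleftrightarrow>
      (\<exists>k. (\<exists>a. \<forall>i. H i = H (i + (k + int l)) + a) \<and> (\<exists>b. \<forall>i. V i = V (i + k) + b))"
    unfolding represents_iso_iff[OF represents_syz_funpow[OF rep n2] rep] add.assoc by blast
  then show ?thesis unfolding neg .
qed

definition periodic_stairs :: "nat \<Rightarrow> nat \<Rightarrow> ((int \<Rightarrow> int) \<times> (int \<Rightarrow> int)) set" where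
  "periodic_stairs n l = {(H, V). H \<in> stairs0 n \<beta> \<and> V \<in> stairs0 n \<alpha> \<and>
     (\<exists>k. k + int l \<in> periods H \<and> k \<in> periods V)}"

lemma syz_periodic_classes_eq:
  assumes n2: "2 \<le> n"
  shows "syz_periodic_classes \<Gamma> n l = stairs_class ` periodic_stairs n l"
proof (intro equalityI subsetI)
  fix C assume "C \<in> syz_periodic_classes \<Gamma> n l"
  then obtain \<Delta> where \<Delta>: "semimodule \<Gamma> \<Delta>" "card (min_gens \<Gamma> \<Delta>) = n"
      "semimodule_iso ((syz \<Gamma> ^^ l) \<Delta>) \<Delta>" "C = iso_rel \<Gamma> `` {\<Delta>}"
    by (auto simp: syz_periodic_classes_def elim!: quotientE)
  obtain n' H V where "represents n' H V \<Delta>" using semimodule_represented[OF \<Delta>(1)] .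
  then have rep: "represents n H V \<Delta>" using represents_card_min_gens \<Delta>(2) by blast
  \<comment> \<open>Rotation by 0 subtracts the initial values and so normalises the pair within its
    class.\<close>
  have "C = stairs_class (rot 0 H, rot 0 V)"
    using represents_class[OF rep] \<Delta>(4) stairs_class_rot by simp
  moreover have "(rot 0 H, rot 0 V) \<in> periodic_stairs n l"
    using \<Delta>(3) rep rot_stairs0
    unfolding represents_syz_iso_iff[OF rep n2] periodic_stairs_def
    by (auto simp: represents_def periods_rot)
  ultimately show "C \<in> stairs_class ` periodic_stairs n l" by blast
next
  fix C assume "C \<in> stairs_class ` periodic_stairs n l"
  then obtain H V where HV: "H \<in> stairs n \<beta>" "V \<in> stairs n \<alpha>" "C = stairs_class (H, V)"
      "\<exists>k. k + int l \<in> periods H \<and> k \<in> periods V"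
    by (auto simp: periodic_stairs_def stairs0_def)
  obtain a \<Delta> where rep: "represents n (\<lambda>i. H i + a) V \<Delta>"
    using represents_exists[OF _ HV(1,2)] n2 by force
  have "C = iso_rel \<Gamma> `` {\<Delta>}"
    unfolding represents_class[OF rep] HV(3) using stairs_class_shift[of H 0 a V 0] by simp
  moreover have "periods (\<lambda>i. H i + a) = periods H" by (simp add: periods_def)
  then have "semimodule_iso ((syz \<Gamma> ^^ l) \<Delta>) \<Delta>"
    using HV(4) unfolding represents_syz_iso_iff[OF rep n2] by simp
  ultimately show "C \<in> syz_periodic_classes \<Gamma> n l"
    using represents_semimodule[OF rep] represents_card_min_gens[OF rep]
    unfolding syz_periodic_classes_def by (auto intro: quotientI)
qed

text \<open>By \<open>common_shift_iff\<close> the condition linking \<open>H\<close> and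
  \<open>V\<close> splits into independent period conditions, so the set becomes a product.\<close>

lemma periodic_stairs_eq:
  assumes n: "0 < n" and lm: "n = l * m"
  shows "periodic_stairs n l =
    (if m dvd \<alpha> * \<beta> then stairs0 (n div gcd m \<beta>) (\<beta> div gcd m \<beta>) \<times> stairs0 (n div gcd m \<alpha>) (\<alpha> div gcd m \<alpha>)
     else {})"
proof -
  have "gcd m \<beta> dvd n" "gcd m \<alpha> dvd n" using lm by (simp_all add: dvd_mult)
  then have sub: "stairs0 (n div gcd m \<beta>) (\<beta> div gcd m \<beta>) = {H \<in> stairs0 n \<beta>. int (n div gcd m \<beta>) \<in> periods H}"
    "stairs0 (n div gcd m \<alpha>) (\<alpha> div gcd m \<alpha>) = {H \<in> stairs0 n \<alpha>. int (n div gcd m \<alpha>) \<in> periods H}"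
    using stairs0_subperiod[OF n] by simp_all
  have "(\<exists>k. k + int l \<in> periods H \<and> k \<in> periods V) \<longleftrightarrow>
      m dvd \<alpha> * \<beta> \<and> int (n div gcd m \<beta>) \<in> periods H \<and> int (n div gcd m \<alpha>) \<in> periods V"
    if "H \<in> stairs0 n \<beta>" "V \<in> stairs0 n \<alpha>" for H V
    using that common_shift_iff[OF cop _ _ n lm] by (simp add: stairs0_def)
  then have "periodic_stairs n l = {(H, V). H \<in> stairs0 n \<beta> \<and> V \<in> stairs0 n \<alpha> \<and>
      m dvd \<alpha> * \<beta> \<and> int (n div gcd m \<beta>) \<in> periods H \<and> int (n div gcd m \<alpha>) \<in> periods V}"
    unfolding periodic_stairs_def by blast
  then show ?thesis unfolding sub by auto
qed

lemma finite_periodic_stairs: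
  assumes "0 < n"
  shows "finite (periodic_stairs n l)"
  by (rule finite_subset[of _ "stairs0 n \<beta> \<times> stairs0 n \<alpha>"])
     (use assms finite_stairs0 \<alpha>_pos \<beta>_pos in \<open>auto simp: periodic_stairs_def\<close>)

lemma card_periodic_stairs:
  assumes n: "0 < n" and lm: "n = l * m" and m: "m dvd \<alpha> * \<beta>"
  shows "card (periodic_stairs n l) =
    ((\<alpha> div gcd m \<alpha> - 1) choose (l * gcd m \<beta> - 1)) * ((\<beta> div gcd m \<beta> - 1) choose (l * gcd m \<alpha> - 1))"
proof -
  have de: "gcd m \<beta> * gcd m \<alpha> = m" by (rule gcd_mult_gcd_coprime[OF cop m])
  have pos: "0 < l" "0 < gcd m \<alpha>" "0 < gcd m \<beta>" using n lm \<alpha>_pos \<beta>_pos by (auto intro: Nat.gr0I)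
  \<comment> \<open>Because \<open>m\<close> is the product of the two gcds, dividing
    \<open>n\<close> by one of them leaves \<open>l\<close> times the other. Hence the lower entry
    of each binomial contains the gcd with the opposite semigroup generator.\<close>
  have "n = gcd m \<beta> * (l * gcd m \<alpha>)" "n = gcd m \<alpha> * (l * gcd m \<beta>)"
    using lm de by (simp_all add: ac_simps)
  then have "n div gcd m \<beta> = l * gcd m \<alpha>" "n div gcd m \<alpha> = l * gcd m \<beta>"
    using pos by (metis nonzero_mult_div_cancel_left less_numeral_extra(3))+
  moreover have "0 < \<alpha> div gcd m \<alpha>" "0 < \<beta> div gcd m \<beta>"
    using \<alpha>_pos \<beta>_pos by (simp_all add: div_greater_zero_iff dvd_imp_le)
  ultimately show ?thesis
    using pos m by (simp add: periodic_stairs_eq[OF n lm] card_cartesian_product card_stairs0)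
qed

lemma rot_periodic_stairs: "(H, V) \<in> periodic_stairs n l \<Longrightarrow> (rot k H, rot k V) \<in> periodic_stairs n l"
  by (auto simp: periodic_stairs_def periods_rot) (auto simp: stairs0_def intro!: rot_stairs0[unfolded stairs0_def, simplified])

text \<open>The fibre is a rotation orbit by \<open>stairs_class_eqD\<close>. Its \<open>n\<close>
  rotations are distinct, since a coincidence would give a common period of \<open>H\<close> and
  \<open>V\<close>, hence a multiple of \<open>n\<close>.\<close>

lemma card_periodic_stairs_fibre:
  assumes n: "0 < n" and "x \<in> periodic_stairs n l"
  shows "card {y \<in> periodic_stairs n l. stairs_class y = stairs_class x} = n"
proof -
  obtain H V where x: "x = (H, V)" by (cases x)
  have H: "H \<in> stairs n \<beta>" and V: "V \<in> stairs n \<alpha>"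
    using assms by (auto simp: x periodic_stairs_def stairs0_def)
  let ?r = "\<lambda>k. (rot k H, rot k V)"
  have "{y \<in> periodic_stairs n l. stairs_class y = stairs_class x} = ?r ` {0..<int n}"
  proof (intro equalityI subsetI)
    fix y assume y: "y \<in> {y \<in> periodic_stairs n l. stairs_class y = stairs_class x}"
    then obtain H' V' where y': "y = (H', V')" "H' \<in> stairs0 n \<beta>" "V' \<in> stairs0 n \<alpha>"
      by (auto simp: periodic_stairs_def)
    then obtain k where "y = ?r k"
      using stairs_class_eqD[OF n H V y'(2,3)] y by (auto simp: x)
    then have "y = ?r (k mod int n)" using rot_mod[OF H] rot_mod[OF V] by simp
    then show "y \<in> ?r ` {0..<int n}" using n by auto
  next
    fix y assume "y \<in> ?r ` {0..<int n}"
    then show "y \<in> {y \<in> periodic_stairs n l. stairs_class y = stairs_class x}"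
      using rot_periodic_stairs assms stairs_class_rot by (auto simp: x)
  qed
  moreover have "inj_on ?r {0..<int n}"
  proof (rule inj_onI)
    fix j k assume jk: "j \<in> {0..<int n}" "k \<in> {0..<int n}" "?r j = ?r k"
    then have "int n dvd j - k"
      using common_period_dvd[OF cop H V n] rot_eq_imp_period by blast
    then have "j mod int n = k mod int n" by (simp add: mod_eq_dvd_iff)
    then show "j = k" using jk by simp
  qed
  ultimately show ?thesis by (simp add: card_image)
qed

lemma card_syz_periodic_classes:
  assumes n2: "2 \<le> n"
  shows "card (periodic_stairs n l) = n * card (syz_periodic_classes \<Gamma> n l)"
  unfolding syz_periodic_classes_eq[OF n2]
  by (rule card_eq_mult_card_image) (use n2 finite_periodic_stairs card_periodic_stairs_fibre in auto)

lemma syz_periodic_classes_one: "syz_periodic_classes \<Gamma> 1 1 = {}"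
proof -
  have "\<not> semimodule_iso (syz \<Gamma> \<Delta>) \<Delta>" if "semimodule \<Gamma> \<Delta>" "card (min_gens \<Gamma> \<Delta>) = 1" for \<Delta>
  proof -
    obtain x where "min_gens \<Gamma> \<Delta> = {x}" using \<open>card _ = 1\<close> by (rule card_1_singletonE)
    then have "syz \<Gamma> \<Delta> = {}" by (simp add: syz_def)
    then show ?thesis using that(1) by (auto simp: semimodule_iso_iff semimodule_def)
  qed
  then show ?thesis by (auto simp: syz_periodic_classes_def quotient_def)
qed

end

text \<open>The formula is tied to \<open>2 \<le> n\<close> and \<open>n div l\<close> dividing
  \<alpha>\<beta>; otherwise there are no classes, yet the formula can be nonzero. It gives 1 for
  \<open>n = l = 1\<close>, and 1/5 for \<alpha> = 2, \<beta> = 3, \<open>n = 5\<close>,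
  \<open>l = 1\<close>. Finiteness is asserted separately because \<open>card\<close> of an infinite
  set is 0.\<close>

theorem theorem5p5:
  fixes \<alpha> \<beta> n l :: nat
  assumes "0 < \<alpha>" and "\<alpha> < \<beta>" and "coprime \<alpha> \<beta>"
    and "0 < n" and "0 < l" and "l dvd n"
  shows "finite (syz_periodic_classes (num_semigroup \<alpha> \<beta>) n l)
    \<and> (2 \<le> n \<and> (n div l) dvd \<alpha> * \<beta> \<longrightarrow>
        real (card (syz_periodic_classes (num_semigroup \<alpha> \<beta>) n l)) =
          1 / real n
          * real ((\<alpha> div gcd (n div l) \<alpha> - 1) choose (l * gcd (n div l) \<beta> - 1))
          * real ((\<beta> div gcd (n div l) \<beta> - 1) choose (l * gcd (n div l) \<alpha> - 1)))
    \<and> (\<not> (2 \<le> n \<and> (n div l) dvd \<alpha> * \<beta>) \<longrightarrow>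
        syz_periodic_classes (num_semigroup \<alpha> \<beta>) n l = {})"
proof -
  interpret coprime_pair \<alpha> \<beta> using assms by unfold_locales auto
  define m where "m = n div l"
  have lm: "n = l * m" using assms by (simp add: m_def)
  show ?thesis
  proof (cases "2 \<le> n")
    case True
    have "real n * real (card (syz_periodic_classes \<Gamma> n l)) =
        real ((\<alpha> div gcd m \<alpha> - 1) choose (l * gcd m \<beta> - 1)) * real ((\<beta> div gcd m \<beta> - 1) choose (l * gcd m \<alpha> - 1))"
      if "m dvd \<alpha> * \<beta>"
      using card_syz_periodic_classes[OF True, of l] card_periodic_stairs[OF assms(4) lm that]
      by (metis of_nat_mult)
    moreover have "syz_periodic_classes \<Gamma> n l = {}" if "\<not> m dvd \<alpha> * \<beta>"
      using that by (simp add: syz_periodic_classes_eq[OF True] periodic_stairs_eq[OF assms(4) lm])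
    moreover have "finite (syz_periodic_classes \<Gamma> n l)"
      using finite_periodic_stairs[OF assms(4)] by (simp add: syz_periodic_classes_eq[OF True])
    ultimately show ?thesis using True by (simp add: field_simps flip: m_def)
  next
    case False
    then have "n = 1" using assms by linarith
    moreover from this have "l = 1" using assms by simp
    ultimately show ?thesis using syz_periodic_classes_one by simp
  qed
qed

end
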